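(* Let $T: L^2([0,1];\mathbb{R})\to L^2([0,1];\mathbb{R})$ be the Douglas--Rachford operator $$Tv = v - P_{\mathcal B}(\gamma v) + P_{\mathcal A}\big(2P_{\mathcal B}(\gamma v) - v\big),\qquad \gamma(t) = \frac{1}{1+r(t)}.$$ If $\varphi$ is a fixed point of $T$ (that is, $T\varphi=\varphi$), then there is a solution $\lambda\in W^{1,2}([0,1];\mathbb{R}^n)$ of $\dot\lambda(t) = -A^T(t)\lambda(t)$ such that, for a.e. $t\in[0,1]$, $$\varphi(t) = u(t)+w(t) = \begin{cases} \overline a(t) - b^T(t)\lambda(t), & \text{if } -b^T(t)\lambda(t) > r(t)\,\overline a(t),\\ -(1+r(t))\,b^T(t)\lambda(t)/r(t), & \text{if } r(t)\,\underline a(t)\le -b^T(t)\lambda(t)\le r(t)\,\overline a(t),\\ \underline a(t) - b^T(t)\lambda(t), & \text{if } -b^T(t)\lambda(t) < r(t)\,\underline a(t),\end{cases}$$ where $u$ is the (unique) solution of the primal problem (P) and $w$ is a solution of the dual problem (D).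
   Context: Data: $A:[0,1]\to\mathbb{R}^{n\times n}$ and $b:[0,1]\to\mathbb{R}^{n\times 1}$ are continuous, $b$ is not the zero vector, $r:[0,1]\to(0,\infty)$ is continuous, $\underline a,\overline a:[0,1]\to\mathbb{R}$ are continuous with $\underline a(t)<\overline a(t)$ for all $t$, and $x_0,x_f\in\mathbb{R}^n$. $W^{1,2}([0,1];\mathbb{R}^n)$ is the space of absolutely continuous $z\in L^2([0,1];\mathbb{R}^n)$ with $\dot z\in L^2([0,1];\mathbb{R}^n)$. Constraint sets: $\mathcal A$ is the set of $u\in L^2([0,1];\mathbb{R})$ for which there exists $x\in W^{1,2}([0,1];\mathbb{R}^n)$ with $\dot x(t) = A(t)x(t)+b(t)u(t)$ for a.e. $t\in[0,1]$, $x(0)=x_0$ and $x(1)=x_f$. $\mathcal B$ is the set of $u\in L^2([0,1];\mathbb{R})$ with $\underline a(t)\le u(t)\le\overline a(t)$ for a.e. $t\in[0,1]$. The control system is assumed controllable, which means $\mathcal A\neq\emptyset$. $P_{\mathcal C}$ denotes the orthogonal projection in $L^2([0,1];\mathbb{R})$ onto a nonempty closed convex set $\mathcal C$. $\gamma v$ is the pointwise product. Primal problem (P): minimize $\frac12\int_0^1 r(t)u^2(t)\,dt$ over $u\in\mathcal A\cap\mathcal B$. Dual problem (D): minimize over $w\in L^2([0,1];\mathbb{R})$ $$\int_0^1\vartheta(w(t),t)\,dt - \big(x_f^Tp(1)-x_0^Tp(0)\big)$$ subject to $\dot p(t)=-A^T(t)p(t)$ and $w(t)=b^T(t)p(t)$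 for all $t\in[0,1]$ (with $p\in W^{1,2}([0,1];\mathbb{R}^n)$), where $$\vartheta(w,t)=\begin{cases}\overline a(t)w - r(t)\overline a(t)^2/2, & w>r(t)\overline a(t),\\ w^2/(2r(t)), & r(t)\underline a(t)\le w\le r(t)\overline a(t),\\ \underline a(t)w-r(t)\underline a(t)^2/2, & w<r(t)\underline a(t).\end{cases}$$ *)

theory Defs
  imports "HOL-Analysis.Analysis"
begin

abbreviation leb01 :: "real measure" where
  "leb01 \<equiv> lebesgue_on {0..1}"

text \<open>
  Elements of \<open>L\<^sup>2\<close> are represented by functions, and equality in \<open>L\<^sup>2\<close> is equality
  almost everywhere on \<open>[0,1]\<close>; values outside \<open>[0,1]\<close> are irrelevant.
\<close>

definition L2 :: "(real \<Rightarrow> 'a::euclidean_space) set" where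
  "L2 = {f. f \<in> borel_measurable leb01 \<and> integrable leb01 (\<lambda>t. (norm (f t))\<^sup>2)}"

definition L2_eq :: "(real \<Rightarrow> 'a::euclidean_space) \<Rightarrow> (real \<Rightarrow> 'a) \<Rightarrow> bool" where
  "L2_eq f g \<longleftrightarrow> (AE t in leb01. f t = g t)"

definition L2_norm :: "(real \<Rightarrow> 'a::euclidean_space) \<Rightarrow> real" where
  "L2_norm f = sqrt (\<integral>t. (norm (f t))\<^sup>2 \<partial>leb01)"

definition abs_cont01 :: "(real \<Rightarrow> 'a::euclidean_space) \<Rightarrow> bool" where
  "abs_cont01 z \<longleftrightarrow>
     (\<forall>\<epsilon>>0. \<exists>\<delta>>0. \<forall>(n::nat) c d.
        (\<forall>i<n. 0 \<le> c i \<and> c i \<le> d i \<and> d i \<le> 1) \<and>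
        disjoint_family_on (\<lambda>i. {c i<..<d i}) {..<n} \<and>
        (\<Sum>i<n. d i - c i) < \<delta>
        \<longrightarrow> (\<Sum>i<n. norm (z (d i) - z (c i))) < \<epsilon>)"

definition W12 :: "(real \<Rightarrow> 'a::euclidean_space) set" where
  "W12 = {z. abs_cont01 z \<and> z \<in> L2 \<and>
     (\<exists>z' \<in> L2. AE t in leb01. (z has_vector_derivative z' t) (at t within {0..1}))}"

definition setA ::
  "(real \<Rightarrow> real^'n^'n) \<Rightarrow> (real \<Rightarrow> real^'n) \<Rightarrow> real^'n \<Rightarrow> real^'n \<Rightarrow> (real \<Rightarrow> real) set" where
  "setA A b x0 xf = {u \<in> L2. \<exists>x \<in> W12.
     (AE t in leb01. (x has_vector_derivative (A t *v x t + u t *\<^sub>R b t)) (at t within {0..1})) \<and>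
     x 0 = x0 \<and> x 1 = xf}"

definition setB :: "(real \<Rightarrow> real) \<Rightarrow> (real \<Rightarrow> real) \<Rightarrow> (real \<Rightarrow> real) set" where
  "setB alo ahi = {u \<in> L2. AE t in leb01. alo t \<le> u t \<and> u t \<le> ahi t}"

text \<open>
  The analogue of \<^const>\<open>closest_point\<close> for \<open>L\<^sup>2\<close>: for a nonempty closed convex \<open>C\<close> the
  nearest point exists and is unique up to equality almost everywhere, so the choice
  only selects a representative.
\<close>

definition proj :: "(real \<Rightarrow> real) set \<Rightarrow> (real \<Rightarrow> real) \<Rightarrow> (real \<Rightarrow> real)" where
  "proj C v = (SOME u. u \<in> C \<and> (\<forall>c\<in>C. L2_norm (\<lambda>t. v t - u t) \<le> L2_norm (\<lambda>t. v t - c t)))"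

definition primal_cost :: "(real \<Rightarrow> real) \<Rightarrow> (real \<Rightarrow> real) \<Rightarrow> real" where
  "primal_cost r u = 1/2 * (\<integral>t. r t * (u t)\<^sup>2 \<partial>leb01)"

definition primal_solution ::
  "(real \<Rightarrow> real^'n^'n) \<Rightarrow> (real \<Rightarrow> real^'n) \<Rightarrow> real^'n \<Rightarrow> real^'n \<Rightarrow>
   (real \<Rightarrow> real) \<Rightarrow> (real \<Rightarrow> real) \<Rightarrow> (real \<Rightarrow> real) \<Rightarrow> (real \<Rightarrow> real) \<Rightarrow> bool" where
  "primal_solution A b x0 xf r alo ahi u \<longleftrightarrow>
     u \<in> setA A b x0 xf \<inter> setB alo ahi \<and>
     (\<forall>v \<in> setA A b x0 xf \<inter> setB alo ahi. primal_cost r u \<le> primal_cost r v)"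

definition adjoint_solution :: "(real \<Rightarrow> real^'n^'n) \<Rightarrow> (real \<Rightarrow> real^'n) \<Rightarrow> bool" where
  "adjoint_solution A p \<longleftrightarrow> p \<in> W12 \<and>
     (\<forall>t\<in>{0..1}. (p has_vector_derivative (- (transpose (A t) *v p t))) (at t within {0..1}))"

definition theta ::
  "(real \<Rightarrow> real) \<Rightarrow> (real \<Rightarrow> real) \<Rightarrow> (real \<Rightarrow> real) \<Rightarrow> real \<Rightarrow> real \<Rightarrow> real" where
  "theta r alo ahi w t =
     (if w > r t * ahi t then ahi t * w - r t * (ahi t)\<^sup>2 / 2
      else if w < r t * alo t then alo t * w - r t * (alo t)\<^sup>2 / 2
      else w\<^sup>2 / (2 * r t))"

definition dual_feasible ::
  "(real \<Rightarrow> real^'n^'n) \<Rightarrow> (real \<Rightarrow> real^'n) \<Rightarrow> (real \<Rightarrow> real) \<Rightarrow> (real \<Rightarrow> real^'n) \<Rightarrow> bool" where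
  "dual_feasible A b w p \<longleftrightarrow>
     w \<in> L2 \<and> adjoint_solution A p \<and> (\<forall>t\<in>{0..1}. w t = b t \<bullet> p t)"

definition dual_cost ::
  "real^'n \<Rightarrow> real^'n \<Rightarrow> (real \<Rightarrow> real) \<Rightarrow> (real \<Rightarrow> real) \<Rightarrow> (real \<Rightarrow> real) \<Rightarrow>
   (real \<Rightarrow> real) \<Rightarrow> (real \<Rightarrow> real^'n) \<Rightarrow> real" where
  "dual_cost x0 xf r alo ahi w p =
     (\<integral>t. theta r alo ahi (w t) t \<partial>leb01) - (xf \<bullet> p 1 - x0 \<bullet> p 0)"

definition dual_solution ::
  "(real \<Rightarrow> real^'n^'n) \<Rightarrow> (real \<Rightarrow> real^'n) \<Rightarrow> real^'n \<Rightarrow> real^'n \<Rightarrow>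
   (real \<Rightarrow> real) \<Rightarrow> (real \<Rightarrow> real) \<Rightarrow> (real \<Rightarrow> real) \<Rightarrow> (real \<Rightarrow> real) \<Rightarrow> bool" where
  "dual_solution A b x0 xf r alo ahi w \<longleftrightarrow>
     (\<exists>p. dual_feasible A b w p \<and>
        (\<forall>v q. dual_feasible A b v q \<longrightarrow>
           dual_cost x0 xf r alo ahi w p \<le> dual_cost x0 xf r alo ahi v q))"

definition gam :: "(real \<Rightarrow> real) \<Rightarrow> real \<Rightarrow> real" where
  "gam r t = 1 / (1 + r t)"

definition DR ::
  "(real \<Rightarrow> real^'n^'n) \<Rightarrow> (real \<Rightarrow> real^'n) \<Rightarrow> real^'n \<Rightarrow> real^'n \<Rightarrow>
   (real \<Rightarrow> real) \<Rightarrow> (real \<Rightarrow> real) \<Rightarrow> (real \<Rightarrow> real) \<Rightarrow> (real \<Rightarrow> real) \<Rightarrow> (real \<Rightarrow> real)" where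
  "DR A b x0 xf r alo ahi v =
     (let y = proj (setB alo ahi) (\<lambda>t. gam r t * v t);
          z = proj (setA A b x0 xf) (\<lambda>t. 2 * y t - v t)
      in (\<lambda>t. v t - y t + z t))"

end

theory Submission
  imports Defs
begin

text \<open>
  A fixed point \<open>\<phi>\<close> of the Douglas--Rachford operator makes the two projections agree:
  \<open>y = P\<^sub>B(\<gamma>\<phi>)\<close> and \<open>z = P\<^sub>A(2y - \<phi>)\<close> satisfy \<open>z = y\<close>, so \<open>u = y\<close> is feasible for the
  primal problem. Everything else is read off from the form of the two projections.

  The set \<open>setA\<close> is an affine subspace of \<open>L\<^sup>2\<close> of finite codimension: a control steers \<open>x\<^sub>0\<close> to
  \<open>x\<^sub>f\<close> iff \<open>\<integral> u g = \<xi>\<close>, where the components of \<open>g\<close> are the functions \<open>b \<bullet> p\<close> for a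
  basis of solutions \<open>p\<close> of the adjoint equation (\<open>setA_characterization\<close>). Hence \<open>v - P\<^sub>A v\<close> is
  a combination of the components of \<open>g\<close>, that is, of the form \<open>b \<bullet> \<lambda>\<close> with \<open>\<lambda>\<close> an adjoint
  solution (\<open>proj_moment_set\<close>), and \<open>z = y\<close> becomes \<open>\<phi> = u - b \<bullet> \<lambda>\<close>. With \<open>w = - b \<bullet> \<lambda>\<close> this is
  \<open>\<phi> = u + w\<close>.

  The projection on the box \<open>setB\<close> is pointwise clamping (\<open>proj_setB\<close>), so \<open>u\<close> is the clamp of
  \<open>(u + w) / (1 + r)\<close> to \<open>[alo, ahi]\<close>; solving this scalar equation for \<open>u\<close> gives the clamp of
  \<open>w / r\<close> (\<open>clamp_resolvent\<close>), which yields the three cases of the formula.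

  That \<open>u\<close> is the clamp of \<open>w / r\<close> means that \<open>u(t)\<close> maximizes \<open>a w(t) - r(t) a\<^sup>2 / 2\<close> over
  \<open>a \<in> [alo(t), ahi(t)]\<close>, with maximal value \<open>\<vartheta>(w(t), t)\<close>. By the pairing identity
  \<open>\<integral> (b \<bullet> p) u = x\<^sub>f \<bullet> p(1) - x\<^sub>0 \<bullet> p(0)\<close> for adjoint solutions \<open>p\<close>, this pointwise optimality
  integrates to optimality of \<open>u\<close> for the primal and of \<open>w\<close> for the dual problem; strict
  convexity gives uniqueness of \<open>u\<close>.

  The analytic work lies in the description of \<open>setA\<close>. Pairing the state with adjoint solutions
  needs the fundamental theorem of calculus for absolutely continuous functions
  (\<open>abs_cont01_has_integral_derivative\<close>). Conversely, building a state for every control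
  with the right moments, which is what makes the projection on \<open>setA\<close> exist, needs a fundamental
  matrix (\<open>linear_ode_exists\<close>), the variation of constants formula, and the almost everywhere
  differentiability of indefinite integrals of \<open>L\<^sup>2\<close> functions.
\<close>

section \<open>Linear differential equations\<close>

lemma continuous_on_bounded01:
  fixes f :: "real \<Rightarrow> 'a::real_normed_vector"
  assumes "continuous_on {0..1} f"
  obtains B where "B > 0" "\<And>t. t \<in> {0..1} \<Longrightarrow> norm (f t) \<le> B"
  using compact_imp_bounded[OF compact_continuous_image[OF assms]] by (auto simp: bounded_pos)

lemma has_vector_derivative_imp_continuous_on:
  assumes "\<And>t. t \<in> S \<Longrightarrow> (f has_vector_derivative f' t) (at t within S)"
  shows "continuous_on S f"
  using assms has_vector_derivative_continuous by (fastforce simp: continuous_on_eq_continuous_within)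

lemma has_vector_derivative_bilinear:
  assumes "bounded_bilinear bop"
    and f: "(f has_vector_derivative f') (at t within S)"
    and g: "(g has_vector_derivative g') (at t within S)"
  shows "((\<lambda>s. bop (f s) (g s)) has_vector_derivative (bop (f t) g' + bop f' (g t))) (at t within S)"
proof -
  interpret bounded_bilinear bop by fact
  show ?thesis
    using FDERIV[OF f[unfolded has_vector_derivative_def] g[unfolded has_vector_derivative_def]]
    by (simp add: has_vector_derivative_def scaleR_left scaleR_right scaleR_add_right)
qed

text \<open>
  Picard iteration, written as a series: the terms \<open>X\<^sub>0 = x\<^sub>0\<close>, \<open>X\<^sub>k\<^sub>+\<^sub>1(t) = \<integral>\<^sub>0\<^sup>t C X\<^sub>k\<close> are bounded by
  \<open>|x\<^sub>0| M\<^sup>k / k!\<close>, so the series and its termwise derivative converge uniformly, and the sum solves the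
  equation. A general bilinear product covers matrix equations as well as systems for vectors.
\<close>

theorem linear_ode_exists:
  fixes bop :: "'b::euclidean_space \<Rightarrow> 'a::euclidean_space \<Rightarrow> 'a" and x0 :: 'a
  assumes bil: "bounded_bilinear bop" and C: "continuous_on {0..1} C"
  obtains x where "x (0::real) = x0"
    and "\<And>t. t \<in> {0..1} \<Longrightarrow> (x has_vector_derivative bop (C t) (x t)) (at t within {0..1})"
proof -
  interpret bounded_bilinear bop by fact
  obtain K where K: "K \<ge> 0" "\<And>a b. norm (bop a b) \<le> norm a * norm b * K"
    using nonneg_bounded by blast
  obtain B where B: "B > 0" "\<And>t. t \<in> {0..1} \<Longrightarrow> norm (C t) \<le> B"
    using continuous_on_bounded01[OF C] by blast
  define M where "M = B * K"
  have M0: "M \<ge> 0" using K B by (simp add: M_def)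
  have M: "norm (bop (C t) y) \<le> M * norm y" if "t \<in> {0..1}" for t y
  proof -
    have "norm (bop (C t) y) \<le> norm (C t) * (norm y * K)" using K(2)[of "C t" y] by (simp add: mult.assoc)
    also have "\<dots> \<le> B * (norm y * K)" by (intro mult_right_mono B that) (simp add: K)
    finally show ?thesis by (simp add: M_def mult_ac)
  qed
  define X where "X = rec_nat (\<lambda>t. x0) (\<lambda>k Y (t::real). integral {0..t} (\<lambda>s. bop (C s) (Y s)))"
  define X' where "X' k t = (case k of 0 \<Rightarrow> 0 | Suc j \<Rightarrow> bop (C t) (X j t))" for k t
  have X_0: "X 0 = (\<lambda>t. x0)" and X_Suc: "X (Suc k) = (\<lambda>t. integral {0..t} (\<lambda>s. bop (C s) (X k s)))" for k
    by (simp_all add: X_def)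
  have deriv: "(X k has_vector_derivative X' k t) (at t within {0..1})"
    and cont: "continuous_on {0..1} (X k)" if "t \<in> {0..1}" for k t
  proof -
    have "(\<forall>t\<in>{0..1}. (X k has_vector_derivative X' k t) (at t within {0..1})) \<and> continuous_on {0..1} (X k)"
    proof (induction k)
      case 0
      then show ?case by (simp add: X_0 X'_def)
    next
      case (Suc k)
      then have "continuous_on {0..1} (\<lambda>s. bop (C s) (X k s))"
        by (intro continuous_on C) auto
      then have d: "\<forall>t\<in>{0..1}. (X (Suc k) has_vector_derivative X' (Suc k) t) (at t within {0..1})"
        unfolding X_Suc X'_def by (auto intro: integral_has_vector_derivative)
      moreover have "continuous_on {0..1} (X (Suc k))"
        using d has_vector_derivative_imp_continuous_on by blast
      ultimately show ?case by blast
    qed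
    with that show "(X k has_vector_derivative X' k t) (at t within {0..1})" "continuous_on {0..1} (X k)"
      by auto
  qed
  have bound: "norm (X k t) \<le> norm x0 * M ^ k * t ^ k / fact k" if "t \<in> {0..1}" for k t
    using that
  proof (induction k arbitrary: t)
    case 0
    then show ?case by (simp add: X_0)
  next
    case (Suc k)
    let ?c = "norm x0 * M ^ Suc k / fact k"
    have "((\<lambda>s. s ^ Suc k / Suc k) has_vector_derivative s ^ k) (at s within {0..t})" for s :: real
    proof -
      have "(s ^ k + real k * s ^ (k - Suc 0) * s) / real (Suc k) = s ^ k"
        by (cases k) (simp_all add: field_simps)
      then show ?thesis
        unfolding has_real_derivative_iff_has_vector_derivative[symmetric]
        by (auto intro!: derivative_eq_intros simp del: of_nat_Suc)
    qed
    from fundamental_theorem_of_calculus[OF _ this]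
    have "((\<lambda>s. s ^ k) has_integral (t ^ Suc k / Suc k)) {0..t}" using Suc.prems by simp
    from has_integral_mult_right[OF this, of ?c]
    have I: "((\<lambda>s. ?c * s ^ k) has_integral (?c * (t ^ Suc k / Suc k))) {0..t}" .
    have "continuous_on {0..1} (\<lambda>s. bop (C s) (X k s))"
      by (intro continuous_on C cont[of t]) (use Suc.prems in auto)
    then have int: "(\<lambda>s. bop (C s) (X k s)) integrable_on {0..t}"
      using Suc.prems by (intro integrable_continuous_real) (auto elim: continuous_on_subset)
    have "norm (X (Suc k) t) \<le> integral {0..t} (\<lambda>s. ?c * s ^ k)"
      unfolding X_Suc
    proof (rule integral_norm_bound_integral[OF int])
      show "(\<lambda>s. ?c * s ^ k) integrable_on {0..t}" using I by blast
      show "norm (bop (C s) (X k s)) \<le> ?c * s ^ k" if "s \<in> {0..t}" for s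
      proof -
        have "norm (bop (C s) (X k s)) \<le> M * norm (X k s)" using that Suc.prems by (intro M) auto
        also have "\<dots> \<le> M * (norm x0 * M ^ k * s ^ k / fact k)"
          using that Suc.prems by (intro mult_left_mono Suc.IH M0) auto
        finally show ?thesis by (simp add: mult_ac)
      qed
    qed
    also have "\<dots> = ?c * (t ^ Suc k / Suc k)" using I by (rule integral_unique)
    also have "\<dots> = norm x0 * M ^ Suc k * t ^ Suc k / fact (Suc k)"
      by (simp add: mult_ac)
    finally show ?case .
  qed
  \<comment> \<open>The factors \<open>t ^ k\<close> were needed to obtain \<open>1 / fact k\<close>; from here on uniform bounds suffice.\<close>
  define m where "m k = norm x0 * (M ^ k / fact k)" for k
  have m_sum: "summable m"
    unfolding m_def by (intro summable_mult) (use summable_exp_generic[of M] in \<open>simp add: divide_inverse mult.commute\<close>)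
  have bound_m: "norm (X k t) \<le> m k" if "t \<in> {0..1}" for k t
  proof -
    have "norm (X k t) \<le> m k * t ^ k" using bound[OF that, of k] by (simp add: m_def)
    also have "\<dots> \<le> m k * 1" using that M0 by (intro mult_left_mono power_le_one) (auto simp: m_def)
    finally show ?thesis by simp
  qed
  define m' where "m' k = (case k of 0 \<Rightarrow> 0 | Suc j \<Rightarrow> M * m j)" for k
  have m'_sum: "summable m'"
  proof -
    have "summable (\<lambda>k. m' (Suc k))" using summable_mult[OF m_sum, of M] by (simp add: m'_def)
    then show ?thesis by (simp add: summable_Suc_iff)
  qed
  have bound_m': "norm (X' k t) \<le> m' k" if "t \<in> {0..1}" for k t
  proof (cases k)
    case (Suc j)
    have "norm (X' k t) \<le> M * norm (X j t)" using M[OF that] by (simp add: Suc X'_def)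
    also have "\<dots> \<le> M * m j" by (intro mult_left_mono bound_m that M0)
    finally show ?thesis by (simp add: Suc m'_def)
  qed (simp add: X'_def m'_def)
  have unif: "uniform_limit {0..1} (\<lambda>n t. \<Sum>i<n. X' i t) (\<lambda>t. suminf (\<lambda>i. X' i t)) sequentially"
    by (rule Weierstrass_m_test[OF _ m'_sum]) (rule bound_m')
  have "\<exists>g. \<forall>t\<in>{0..1}. (\<lambda>n. X n t) sums g t \<and> 
     (g has_derivative (\<lambda>h. h *\<^sub>R suminf (\<lambda>i. X' i t))) (at t within {0..1})"
  proof (rule has_derivative_series[where f' = "\<lambda>i t h. h *\<^sub>R X' i t" and x = 0])
    show "(X n has_derivative (\<lambda>h. h *\<^sub>R X' n t)) (at t within {0..1})" if "t \<in> {0..1}" for n t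
      using deriv[OF that] by (simp add: has_vector_derivative_def)
    show "\<forall>\<^sub>F n in sequentially. \<forall>t\<in>{0..1}. \<forall>h. norm ((\<Sum>i<n. h *\<^sub>R X' i t) - h *\<^sub>R suminf (\<lambda>i. X' i t)) \<le> e * norm h"
      if "e > 0" for e
      using uniform_limitD[OF unif that]
    proof eventually_elim
      case (elim n)
      show ?case
      proof (intro ballI allI)
        fix t :: real and h :: real assume "t \<in> {0..1}"
        with elim have "norm ((\<Sum>i<n. X' i t) - suminf (\<lambda>i. X' i t)) \<le> e" by (auto simp: dist_norm less_imp_le)
        then have "norm h * norm ((\<Sum>i<n. X' i t) - suminf (\<lambda>i. X' i t)) \<le> norm h * e"
          by (intro mult_left_mono) auto
        then show "norm ((\<Sum>i<n. h *\<^sub>R X' i t) - h *\<^sub>R suminf (\<lambda>i. X' i t)) \<le> e * norm h"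
          by (simp add: scaleR_sum_right[symmetric] scaleR_diff_right[symmetric] mult.commute)
      qed
    qed
    show "(\<lambda>n. X n 0) sums suminf (\<lambda>n. X n 0)"
      by (intro summable_sums summable_comparison_test'[OF m_sum] bound_m) auto
  qed auto
  then obtain x where x: "\<And>t. t \<in> {0..1} \<Longrightarrow> (\<lambda>n. X n t) sums x t"
    "\<And>t. t \<in> {0..1} \<Longrightarrow> (x has_vector_derivative suminf (\<lambda>i. X' i t)) (at t within {0..1})"
    unfolding has_vector_derivative_def by blast
  show thesis
  proof
    have "X n 0 = (if n = 0 then x0 else 0)" for n
      by (cases n) (simp_all add: X_0 X_Suc)
    then have "(\<lambda>n. X n 0) sums x0" using sums_single[of 0 "\<lambda>_. x0"] by simp
    then show "x 0 = x0" using x(1)[of 0] sums_unique2 by auto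
    show "(x has_vector_derivative bop (C t) (x t)) (at t within {0..1})" if t: "t \<in> {0..1}" for t
    proof -
      have "(\<lambda>n. bop (C t) (X n t)) sums bop (C t) (x t)"
        by (rule bounded_linear.sums[OF bounded_linear_right x(1)[OF t]])
      then have "(\<lambda>n. X' (Suc n) t) sums bop (C t) (x t)" by (simp add: X'_def)
      then have "(\<lambda>n. X' n t) sums (bop (C t) (x t) + X' 0 t)" by (rule sums_Suc)
      then have "suminf (\<lambda>i. X' i t) = bop (C t) (x t)" by (simp add: sums_iff X'_def)
      then show ?thesis using x(2)[OF t] by simp
    qed
  qed
qed

lemma bounded_bilinear_matrix_matrix_mult:
  "bounded_bilinear ((**) :: real^'m^'n \<Rightarrow> real^'k^'m \<Rightarrow> real^'k^'n)"
  unfolding bilinear_conv_bounded_bilinear[symmetric] bilinear_def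
  by (auto intro!: linearI simp: matrix_add_ldistrib matrix_matrix_mult_def vec_eq_iff algebra_simps sum.distrib sum_distrib_left)

lemma bounded_bilinear_matrix_vector_mult:
  "bounded_bilinear ((*v) :: real^'m^'n \<Rightarrow> real^'m \<Rightarrow> real^'n)"
  unfolding bilinear_conv_bounded_bilinear[symmetric] bilinear_def
  by (auto intro!: linearI simp: matrix_vector_mult_def vec_eq_iff algebra_simps sum.distrib sum_distrib_left)

lemma bounded_linear_transpose: "bounded_linear (transpose :: real^'m^'n \<Rightarrow> real^'n^'m)"
  unfolding linear_conv_bounded_linear[symmetric]
  by (auto intro!: linearI simp: transpose_def vec_eq_iff)

text \<open>
  \<open>\<Phi>\<close> propagates the state equation and \<open>P\<close> the adjoint equation. The derivative of
  \<open>P\<^sup>T \<Phi>\<close> vanishes, so \<open>P\<^sup>T\<close> is the inverse of \<open>\<Phi>\<close>; for square matrices a left inverse is also a right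
  inverse.
\<close>

lemma fundamental_matrices_exist:
  fixes A :: "real \<Rightarrow> real^'n^'n"
  assumes A: "continuous_on {0..1} A"
  obtains \<Phi> P where "\<Phi> 0 = mat 1" "P 0 = mat 1"
    and "\<And>t. t \<in> {0..1} \<Longrightarrow> (\<Phi> has_vector_derivative A t ** \<Phi> t) (at t within {0..1})"
    and "\<And>t. t \<in> {0..1} \<Longrightarrow> (P has_vector_derivative (- transpose (A t)) ** P t) (at t within {0..1})"
    and "\<And>t. t \<in> {0..1} \<Longrightarrow> \<Phi> t ** transpose (P t) = mat 1"
proof -
  obtain \<Phi> where \<Phi>: "\<Phi> 0 = mat 1" 
    "\<And>t. t \<in> {0..1} \<Longrightarrow> (\<Phi> has_vector_derivative A t ** \<Phi> t) (at t within {0..1})"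
    by (rule linear_ode_exists[OF bounded_bilinear_matrix_matrix_mult A]) (rule that, assumption, blast)
  have A': "continuous_on {0..1} (\<lambda>t. - transpose (A t))"
    by (intro continuous_intros bounded_linear.continuous_on[OF bounded_linear_transpose] A)
  obtain P where P: "P 0 = mat 1" 
    "\<And>t. t \<in> {0..1} \<Longrightarrow> (P has_vector_derivative (- transpose (A t)) ** P t) (at t within {0..1})"
    by (rule linear_ode_exists[OF bounded_bilinear_matrix_matrix_mult A']) (rule that, assumption, blast)
  interpret mm: bounded_bilinear "(**) :: real^'n^'n \<Rightarrow> real^'n^'n \<Rightarrow> real^'n^'n"
    by (rule bounded_bilinear_matrix_matrix_mult)
  have "((\<lambda>s. transpose (P s) ** \<Phi> s) has_vector_derivative 0) (at t within {0..1})" if t: "t \<in> {0..1}" for t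
  proof -
    have "((\<lambda>s. transpose (P s)) has_vector_derivative transpose ((- transpose (A t)) ** P t)) (at t within {0..1})"
      by (rule bounded_linear.has_vector_derivative[OF bounded_linear_transpose P(2)[OF t]])
    from has_vector_derivative_bilinear[OF bounded_bilinear_matrix_matrix_mult this \<Phi>(2)[OF t]]
    show ?thesis
      by (simp add: mm.minus_left mm.minus_right matrix_transpose_mul transpose_transpose matrix_mul_assoc
          linear_neg[OF bounded_linear.linear[OF bounded_linear_transpose]])
  qed
  then have "\<And>t. t \<in> {0..1} \<Longrightarrow> transpose (P t) ** \<Phi> t = transpose (P 0) ** \<Phi> 0"
    by (metis (no_types, lifting) has_vector_derivative_zero_constant[OF convex_real_interval(5)] atLeastAtMost_iff le_numeral_extra(3) zero_le_one)
  then have 1: "transpose (P t) ** \<Phi> t = mat 1" if "t \<in> {0..1}" for t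
    using that \<Phi>(1) P(1) by (simp add: transpose_mat)
  then have "\<Phi> t ** transpose (P t) = mat 1" if "t \<in> {0..1}" for t
    using that matrix_left_right_inverse by blast
  from that[OF \<Phi>(1) P(1) \<Phi>(2) P(2) this] show thesis .
qed

section \<open>Absolutely continuous functions\<close>

lemma AE_leb01_iff: "(AE t in leb01. P t) \<longleftrightarrow> (\<exists>N. negligible N \<and> (\<forall>t\<in>{0..1} - N. P t))"
proof -
  have "(AE t in leb01. P t) \<longleftrightarrow> (AE t in lebesgue. t \<in> {0..1} \<longrightarrow> P t)"
    by (rule AE_restrict_space_iff) simp
  also have "\<dots> \<longleftrightarrow> (\<exists>N. negligible N \<and> {t. \<not> (t \<in> {0..1} \<longrightarrow> P t)} \<subseteq> N)"
    unfolding eventually_ae_filter negligible_iff_null_sets Bex_def by simp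
  also have "\<dots> \<longleftrightarrow> (\<exists>N. negligible N \<and> (\<forall>t\<in>{0..1} - N. P t))"
  proof (rule arg_cong[where f = Ex], rule ext)
    show "(negligible N \<and> {t. \<not> (t \<in> {0..1} \<longrightarrow> P t)} \<subseteq> N) = (negligible N \<and> (\<forall>t\<in>{0..1} - N. P t))" for N
      by auto
  qed
  finally show ?thesis .
qed

lemma abs_cont01D:
  assumes "abs_cont01 z" "\<epsilon> > 0"
  obtains \<delta> where "\<delta> > 0"
    and "\<And>(n::nat) c d. \<lbrakk>\<And>i. i < n \<Longrightarrow> 0 \<le> c i \<and> c i \<le> d i \<and> d i \<le> 1;
        disjoint_family_on (\<lambda>i. {c i<..<d i}) {..<n}; (\<Sum>i<n. d i - c i) < \<delta>\<rbrakk>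
      \<Longrightarrow> (\<Sum>i<n. norm (z (d i) - z (c i))) < \<epsilon>"
proof -
  obtain \<delta> where \<delta>: "\<delta> > 0" and ac: "\<forall>(n::nat) c d.
        (\<forall>i<n. 0 \<le> c i \<and> c i \<le> d i \<and> d i \<le> 1) \<and>
        disjoint_family_on (\<lambda>i. {c i<..<d i}) {..<n} \<and>
        (\<Sum>i<n. d i - c i) < \<delta>
        \<longrightarrow> (\<Sum>i<n. norm (z (d i) - z (c i))) < \<epsilon>"
    using assms unfolding abs_cont01_def by blast
  show thesis by (rule that[OF \<delta>]) (use ac in simp)
qed

lemma abs_cont01_imp_continuous_on:
  assumes "abs_cont01 z"
  shows "continuous_on {0..1} z"
  unfolding continuous_on_iff
proof (intro ballI allI impI)
  fix s \<epsilon> :: real assume s: "s \<in> {0..1}" and "\<epsilon> > 0"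
  obtain \<delta> where \<delta>: "\<delta> > 0" and ac: "\<And>(n::nat) c d. \<lbrakk>\<And>i. i < n \<Longrightarrow> 0 \<le> c i \<and> c i \<le> d i \<and> d i \<le> 1;
        disjoint_family_on (\<lambda>i. {c i<..<d i}) {..<n}; (\<Sum>i<n. d i - c i) < \<delta>\<rbrakk>
      \<Longrightarrow> (\<Sum>i<n. norm (z (d i) - z (c i))) < \<epsilon>"
    using abs_cont01D[OF assms \<open>\<epsilon> > 0\<close>] by blast
  have "dist (z t) (z s) < \<epsilon>" if t: "t \<in> {0..1}" "dist t s < \<delta>" for t
    using ac[of 1 "\<lambda>_. min s t" "\<lambda>_. max s t"] s t
    by (cases "s \<le> t") (auto simp: dist_norm disjoint_family_on_def norm_minus_commute max_def min_def)
  with \<delta> show "\<exists>\<delta>>0. \<forall>t\<in>{0..1}. dist t s < \<delta> \<longrightarrow> dist (z t) (z s) < \<epsilon>" by blast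
qed

lemma abs_cont01_if_bounded_derivative:
  assumes deriv: "\<And>t. t \<in> {0..1} \<Longrightarrow> (z has_vector_derivative z' t) (at t within {0..1})"
    and cont: "continuous_on {0..1} z'"
  shows "abs_cont01 z"
proof -
  obtain B where B: "B > 0" "\<And>t. t \<in> {0..1} \<Longrightarrow> norm (z' t) \<le> B"
    using continuous_on_bounded01[OF cont] by blast
  have lip: "norm (z d - z c) \<le> B * norm (d - c)" if "c \<in> {0..1}" "d \<in> {0..1}" for c d
  proof (rule differentiable_bound[of "{0..1}" z "\<lambda>t h. h *\<^sub>R z' t"])
    show "(z has_derivative (\<lambda>h. h *\<^sub>R z' t)) (at t within {0..1})" if "t \<in> {0..1}" for t
      using deriv[OF that] by (simp add: has_vector_derivative_def)
    show "onorm (\<lambda>h. h *\<^sub>R z' t) \<le> B" if "t \<in> {0..1}" for t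
      by (rule onorm_le) (use B(2)[OF that] in \<open>simp add: mult.commute[of _ "norm (z' t)"] mult_right_mono\<close>)
  qed (use that in auto)
  show ?thesis
    unfolding abs_cont01_def
  proof (intro allI impI)
    fix \<epsilon> :: real assume e: "\<epsilon> > 0"
    show "\<exists>\<delta>>0. \<forall>(n::nat) c d.
        (\<forall>i<n. 0 \<le> c i \<and> c i \<le> d i \<and> d i \<le> 1) \<and>
        disjoint_family_on (\<lambda>i. {c i<..<d i}) {..<n} \<and>
        (\<Sum>i<n. d i - c i) < \<delta>
        \<longrightarrow> (\<Sum>i<n. norm (z (d i) - z (c i))) < \<epsilon>"
    proof (intro exI[of _ "\<epsilon> / B"] conjI allI impI; (elim conjE)?)
      fix n and c d :: "nat \<Rightarrow> real"
      assume cd: "\<forall>i<n. 0 \<le> c i \<and> c i \<le> d i \<and> d i \<le> 1" and s: "(\<Sum>i<n. d i - c i) < \<epsilon> / B"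
      have "norm (z (d i) - z (c i)) \<le> B * (d i - c i)" if "i < n" for i
      proof -
        have "0 \<le> c i" "c i \<le> d i" "d i \<le> 1" using cd that by auto
        then show ?thesis using lip[of "c i" "d i"] by simp
      qed
      then have "(\<Sum>i<n. norm (z (d i) - z (c i))) \<le> (\<Sum>i<n. B * (d i - c i))"
        by (intro sum_mono) auto
      also have "\<dots> = B * (\<Sum>i<n. d i - c i)" by (simp add: sum_distrib_left)
      also have "\<dots> < B * (\<epsilon> / B)" by (intro mult_strict_left_mono s B)
      finally show "(\<Sum>i<n. norm (z (d i) - z (c i))) < \<epsilon>" using B by simp
    qed (use e B in auto)
  qed
qed

lemma abs_cont01_bilinear:
  assumes bil: "bounded_bilinear bop" and f: "abs_cont01 f" and g: "abs_cont01 g"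
  shows "abs_cont01 (\<lambda>t. bop (f t) (g t))"
proof -
  interpret bounded_bilinear bop by fact
  obtain K where K: "K > 0" "\<And>a b. norm (bop a b) \<le> norm a * norm b * K"
    using pos_bounded by blast
  obtain B1 where B1: "B1 > 0" "\<And>t. t \<in> {0..1} \<Longrightarrow> norm (f t) \<le> B1"
    using continuous_on_bounded01[OF abs_cont01_imp_continuous_on[OF f]] by blast
  obtain B2 where B2: "B2 > 0" "\<And>t. t \<in> {0..1} \<Longrightarrow> norm (g t) \<le> B2"
    using continuous_on_bounded01[OF abs_cont01_imp_continuous_on[OF g]] by blast
  show ?thesis
    unfolding abs_cont01_def
  proof (intro allI impI)
    fix \<epsilon> :: real assume e: "\<epsilon> > 0"
    obtain \<delta>1 where \<delta>1: "\<delta>1 > 0" and ac1: "\<And>(n::nat) c d. \<lbrakk>\<And>i. i < n \<Longrightarrow> 0 \<le> c i \<and> c i \<le> d i \<and> d i \<le> 1;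
        disjoint_family_on (\<lambda>i. {c i<..<d i}) {..<n}; (\<Sum>i<n. d i - c i) < \<delta>1\<rbrakk>
      \<Longrightarrow> (\<Sum>i<n. norm (f (d i) - f (c i))) < \<epsilon> / (2 * B2 * K)"
      using abs_cont01D[OF f, of "\<epsilon> / (2 * B2 * K)"] e K B2 by auto
    obtain \<delta>2 where \<delta>2: "\<delta>2 > 0" and ac2: "\<And>(n::nat) c d. \<lbrakk>\<And>i. i < n \<Longrightarrow> 0 \<le> c i \<and> c i \<le> d i \<and> d i \<le> 1;
        disjoint_family_on (\<lambda>i. {c i<..<d i}) {..<n}; (\<Sum>i<n. d i - c i) < \<delta>2\<rbrakk>
      \<Longrightarrow> (\<Sum>i<n. norm (g (d i) - g (c i))) < \<epsilon> / (2 * B1 * K)"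
      using abs_cont01D[OF g, of "\<epsilon> / (2 * B1 * K)"] e K B1 by auto
    show "\<exists>\<delta>>0. \<forall>(n::nat) c d.
        (\<forall>i<n. 0 \<le> c i \<and> c i \<le> d i \<and> d i \<le> 1) \<and>
        disjoint_family_on (\<lambda>i. {c i<..<d i}) {..<n} \<and>
        (\<Sum>i<n. d i - c i) < \<delta>
        \<longrightarrow> (\<Sum>i<n. norm (bop (f (d i)) (g (d i)) - bop (f (c i)) (g (c i)))) < \<epsilon>"
    proof (intro exI[of _ "min \<delta>1 \<delta>2"] conjI allI impI; (elim conjE)?)
      fix n and c d :: "nat \<Rightarrow> real"
      assume cd: "\<forall>i<n. 0 \<le> c i \<and> c i \<le> d i \<and> d i \<le> 1" 
        and dis: "disjoint_family_on (\<lambda>i. {c i<..<d i}) {..<n}"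
        and s: "(\<Sum>i<n. d i - c i) < min \<delta>1 \<delta>2"
      have step: "norm (bop (f (d i)) (g (d i)) - bop (f (c i)) (g (c i)))
          \<le> B2 * K * norm (f (d i) - f (c i)) + B1 * K * norm (g (d i) - g (c i))" if "i < n" for i
      proof -
        have i: "c i \<in> {0..1}" "d i \<in> {0..1}" using cd that by force+
        have "norm (bop (f (d i)) (g (d i)) - bop (f (c i)) (g (c i))) =
           norm (bop (f (d i) - f (c i)) (g (d i)) + bop (f (c i)) (g (d i) - g (c i)))"
          by (simp add: diff_left diff_right)
        also have "\<dots> \<le> norm (f (d i) - f (c i)) * norm (g (d i)) * K + norm (f (c i)) * norm (g (d i) - g (c i)) * K"
          by (rule order.trans[OF norm_triangle_ineq add_mono[OF K(2) K(2)]])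
        also have "\<dots> \<le> norm (f (d i) - f (c i)) * B2 * K + B1 * norm (g (d i) - g (c i)) * K"
          using i K(1) by (intro add_mono mult_right_mono mult_left_mono B1 B2) auto
        finally show ?thesis by (simp add: mult_ac)
      qed
      have "(\<Sum>i<n. norm (bop (f (d i)) (g (d i)) - bop (f (c i)) (g (c i))))
         \<le> (\<Sum>i<n. B2 * K * norm (f (d i) - f (c i)) + B1 * K * norm (g (d i) - g (c i)))"
        by (intro sum_mono step) auto
      also have "\<dots> = B2 * K * (\<Sum>i<n. norm (f (d i) - f (c i))) + B1 * K * (\<Sum>i<n. norm (g (d i) - g (c i)))"
        by (simp add: sum.distrib sum_distrib_left)
      also have "\<dots> < B2 * K * (\<epsilon> / (2 * B2 * K)) + B1 * K * (\<epsilon> / (2 * B1 * K))"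
        using B1 B2 K(1) cd s dis by (intro add_strict_mono mult_strict_left_mono ac1 ac2) auto
      also have "\<dots> = \<epsilon>" using B1 B2 K by (simp add: field_simps)
      finally show "(\<Sum>i<n. norm (bop (f (d i)) (g (d i)) - bop (f (c i)) (g (c i)))) < \<epsilon>" .
    qed (use \<delta>1 \<delta>2 in auto)
  qed
qed

text \<open>
  Outer regularity; it lets absolute continuity take care of a null set of exceptional points.
\<close>

lemma negligible_subset_small_open:
  fixes N :: "real set"
  assumes "negligible N" "\<delta> > 0"
  obtains U where "open U" "N \<subseteq> U" "emeasure lebesgue U < ennreal \<delta>"
proof -
  have N: "N \<in> null_sets lebesgue" using assms by (simp add: negligible_iff_null_sets)
  obtain U where U: "open U" "N \<subseteq> U" "(U - N) \<in> lmeasurable" "emeasure lebesgue (U - N) < ennreal \<delta>"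
    using sets_lebesgue_outer_open[OF _ assms(2)] N by blast
  have "emeasure lebesgue U = emeasure lebesgue (U - N)"
    using emeasure_Diff_null_set[OF N, of U] U(1) by auto
  with U that show thesis by auto
qed

text \<open>
  The fundamental theorem of calculus for absolutely continuous functions, by choosing a gauge.
  At a tag \<open>x\<close> where \<open>z\<close> is differentiable the gauge makes the Riemann term \<open>|K| z'(x)\<close> close to the increment of
  \<open>z\<close> over \<open>K\<close>, relative to \<open>|K|\<close>. The remaining tags lie in a null set \<open>N\<close>, where the integrand may be changed to
  \<open>0\<close>; there the gauge forces the intervals into an open set of measure less than \<open>\<delta>\<close>, so that absolute
  continuity bounds the sum of the increments of \<open>z\<close>.
\<close>

theorem abs_cont01_has_integral_derivative:
  fixes z :: "real \<Rightarrow> 'a::euclidean_space"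
  assumes ac: "abs_cont01 z"
    and deriv: "AE t in leb01. (z has_vector_derivative z' t) (at t within {0..1})"
  shows "(z' has_integral (z 1 - z 0)) {0..1}"
proof -
  obtain N where N: "negligible N"
    and dN: "\<And>t. t \<in> {0..1} - N \<Longrightarrow> (z has_vector_derivative z' t) (at t within {0..1})"
    using deriv[unfolded AE_leb01_iff] by blast
  define f where "f t = (if t \<in> N then 0 else z' t)" for t
  have "(f has_integral (z 1 - z 0)) {0..1}"
    unfolding has_integral_real
  proof (intro allI impI)
    fix e :: real assume e: "e > 0"
    obtain \<delta> where \<delta>: "\<delta> > 0" and ac': "\<And>(n::nat) c d. \<lbrakk>\<And>i. i < n \<Longrightarrow> 0 \<le> c i \<and> c i \<le> d i \<and> d i \<le> 1;
        disjoint_family_on (\<lambda>i. {c i<..<d i}) {..<n}; (\<Sum>i<n. d i - c i) < \<delta>\<rbrakk>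
      \<Longrightarrow> (\<Sum>i<n. norm (z (d i) - z (c i))) < e/2"
      using abs_cont01D[OF ac, of "e/2"] e by auto
    obtain U where U: "open U" "N \<subseteq> U" "emeasure lebesgue U < ennreal \<delta>"
      using negligible_subset_small_open[OF N \<delta>] by blast
    have "\<exists>d>0. (x \<in> N \<longrightarrow> ball x d \<subseteq> U) \<and> (x \<in> {0..1} - N \<longrightarrow>
         (\<forall>y\<in>{0..1}. norm (y-x) < d \<longrightarrow> norm (z y - z x - (y-x) *\<^sub>R f x) \<le> e/4 * norm (y-x)))" for x
    proof (cases "x \<in> N")
      case True
      then show ?thesis using U open_contains_ball by auto
    next
      case False
      show ?thesis
      proof (cases "x \<in> {0..1}")
        case True
        with dN[of x] False have "(z has_derivative (\<lambda>h. h *\<^sub>R f x)) (at x within {0..1})"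
          by (simp add: f_def has_vector_derivative_def)
        then show ?thesis 
          using e False unfolding has_derivative_within_alt by (metis divide_pos_pos zero_less_numeral)
      next
        case out: False
        with False show ?thesis by (intro exI[of _ 1]) auto
      qed
    qed
    then obtain d where d': "\<forall>x. d x > 0 \<and> (x \<in> N \<longrightarrow> ball x (d x) \<subseteq> U) \<and> (x \<in> {0..1} - N \<longrightarrow>
         (\<forall>y\<in>{0..1}. norm (y-x) < d x \<longrightarrow> norm (z y - z x - (y-x) *\<^sub>R f x) \<le> e/4 * norm (y-x)))"
      by metis
    then have d: "\<And>x. d x > 0" "\<And>x. x \<in> N \<Longrightarrow> ball x (d x) \<subseteq> U"
      "\<And>x y. \<lbrakk>x \<in> {0..1} - N; y \<in> {0..1}; norm (y-x) < d x\<rbrakk> \<Longrightarrow> norm (z y - z x - (y-x) *\<^sub>R f x) \<le> e/4 * norm (y-x)"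
      by blast+
    show "\<exists>\<gamma>. gauge \<gamma> \<and> (\<forall>\<D>. \<D> tagged_division_of {0..1} \<and> \<gamma> fine \<D> \<longrightarrow>
            norm ((\<Sum>(x, k)\<in>\<D>. measure lborel k *\<^sub>R f x) - (z 1 - z 0)) < e)"
    proof (intro exI conjI allI impI; (elim conjE)?)
      show "gauge (\<lambda>x. ball x (d x))" using d(1) gauge_ball_dependent by blast
      fix p assume p: "p tagged_division_of {0..1::real}" and fine: "(\<lambda>x. ball x (d x)) fine p"
      have fin: "finite p" using p by blast
      have K: "\<exists>u v. K = {u..v} \<and> u \<le> x \<and> x \<le> v \<and> 0 \<le> u \<and> v \<le> 1 \<and> {u..v} \<subseteq> ball x (d x) \<and>
          Inf K = u \<and> Sup K = v \<and> measure lborel K = v - u" if "(x, K) \<in> p" for x K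
      proof -
        have xK: "x \<in> K" "K \<subseteq> {0..1}" "\<exists>u v. K = cbox u v" 
          using tagged_division_ofD(2,3,4)[OF p that] by auto
        moreover have "K \<subseteq> ball x (d x)" using fine that by (auto simp: fine_def)
        ultimately show ?thesis by auto
      qed
      let ?D = "\<lambda>(x, K). measure lborel K *\<^sub>R f x - (z (Sup K) - z (Inf K))"
      define p1 where "p1 = {q \<in> p. fst q \<notin> N}"
      define p2 where "p2 = {q \<in> p. fst q \<in> N}"
      have p12: "p = p1 \<union> p2" "p1 \<inter> p2 = {}" "finite p1" "finite p2" using fin by (auto simp: p1_def p2_def)
      have ba: "1 - 0 = (\<Sum>(x,K)\<in>p. Sup K - Inf K)" "z 1 - z 0 = (\<Sum>(x,K)\<in>p. z (Sup K) - z (Inf K))"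
        using additive_tagged_division_1[OF _ p, of "\<lambda>x. x"] additive_tagged_division_1[OF _ p, of z]
        by auto
      \<comment> \<open>Outside \<open>N\<close> the error of each term is at most \<open>e/4\<close> times the length of its interval, and the lengths add up to \<open>1\<close>.\<close>
      have "norm (\<Sum>q\<in>p1. ?D q) \<le> (\<Sum>(x,K)\<in>p1. e/4 * (Sup K - Inf K))"
      proof (rule sum_norm_le, clarify)
        fix x K assume xK: "(x, K) \<in> p1"
        then have "(x, K) \<in> p" by (simp add: p1_def)
        from K[OF this] obtain u v where uv: "K = {u..v}" "u \<le> x" "x \<le> v" "0 \<le> u" "v \<le> 1" "{u..v} \<subseteq> ball x (d x)"
          "Inf K = u" "Sup K = v" "measure lborel K = v - u" by blast
        have x: "x \<in> {0..1} - N" using xK uv by (auto simp: p1_def)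
        have "u \<in> ball x (d x)" "v \<in> ball x (d x)"
          by (rule subsetD[OF uv(6)], use uv in simp)+
        have "norm (z u - z x - (u-x) *\<^sub>R f x) \<le> e/4 * norm (u-x)"
          "norm (z v - z x - (v-x) *\<^sub>R f x) \<le> e/4 * norm (v-x)"
          by (rule d(3)[OF x]; use uv \<open>u \<in> ball x (d x)\<close> \<open>v \<in> ball x (d x)\<close> in \<open>simp add: dist_real_def\<close>)+
        moreover have "norm ((v-u) *\<^sub>R f x - (z v - z u)) \<le> 
           norm (z u - z x - (u-x) *\<^sub>R f x) + norm (z v - z x - (v-x) *\<^sub>R f x)"
          by (rule order.trans[OF _ norm_triangle_ineq4]) (simp add: algebra_simps)
        ultimately have "norm ((v-u) *\<^sub>R f x - (z v - z u)) \<le> e/4 * norm (u-x) + e/4 * norm (v-x)" by linarith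
        also have "\<dots> = e/4 * ((x - u) + (v - x))"
          using uv by (subst distrib_left) simp
        also have "\<dots> = e/4 * (v - u)" by simp
        finally show "norm (measure lborel K *\<^sub>R f x - (z (Sup K) - z (Inf K))) \<le> e/4 * (Sup K - Inf K)"
          using uv by simp
      qed
      also have "\<dots> \<le> (\<Sum>(x,K)\<in>p. e/4 * (Sup K - Inf K))"
      proof (rule sum_mono2[OF fin])
        show "p1 \<subseteq> p" by (auto simp: p1_def)
        show "0 \<le> (case q of (x, K) \<Rightarrow> e/4 * (Sup K - Inf K))" if "q \<in> p - p1" for q
          using K[of "fst q" "snd q"] that e by (auto simp: split_beta)
      qed
      also have "\<dots> = e/4 * (\<Sum>(x,K)\<in>p. Sup K - Inf K)" by (simp add: sum_distrib_left split_beta)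
      finally have 1: "norm (\<Sum>q\<in>p1. ?D q) \<le> e/4" using ba(1) by simp
      \<comment> \<open>The intervals tagged in \<open>N\<close> have to be enumerated in order to apply absolute continuity to them.\<close>
      obtain h where h: "bij_betw h {..<card p2} p2" 
        using ex_bij_betw_nat_finite[OF p12(4)] by (auto simp: atLeast0LessThan)
      define n where "n = card p2"
      have h': "inj_on h {..<n}" "h ` {..<n} = p2" using h by (auto simp: bij_betw_def n_def)
      have hp: "h i \<in> p2" if "i < n" for i using h'(2) that by auto
      define c where "c i = Inf (snd (h i))" for i
      define d' where "d' i = Sup (snd (h i))" for i
      have cd: "0 \<le> c i \<and> c i \<le> d' i \<and> d' i \<le> 1 \<and> {c i<..<d' i} \<subseteq> U \<and> interior (snd (h i)) = {c i<..<d' i}" 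
        if "i < n" for i
      proof -
        have q: "(fst (h i), snd (h i)) \<in> p" "fst (h i) \<in> N" using hp[OF that] by (auto simp: p2_def)
        obtain u v where uv: "snd (h i) = {u..v}" "u \<le> v" "0 \<le> u" "v \<le> 1" 
          "{u..v} \<subseteq> ball (fst (h i)) (d (fst (h i)))" "Inf (snd (h i)) = u" "Sup (snd (h i)) = v"
          using K[OF q(1)] by force
        have "{u<..<v} \<subseteq> U" using uv(5) d(2)[OF q(2)] by force
        then show ?thesis using uv by (simp add: c_def d'_def interior_atLeastAtMost_real)
      qed
      have dis: "disjoint_family_on (\<lambda>i. {c i<..<d' i}) {..<n}"
        unfolding disjoint_family_on_def
      proof (intro ballI impI)
        fix i j assume ij: "i \<in> {..<n}" "j \<in> {..<n}" "i \<noteq> j"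
        then have "h i \<noteq> h j" using h'(1) by (auto dest: inj_onD)
        moreover have "(fst (h i), snd (h i)) \<in> p" "(fst (h j), snd (h j)) \<in> p" 
          using hp ij by (auto simp: p2_def)
        ultimately have "interior (snd (h i)) \<inter> interior (snd (h j)) = {}"
          by (intro tagged_division_ofD(5)[OF p]) (auto simp: prod_eq_iff)
        then show "{c i<..<d' i} \<inter> {c j<..<d' j} = {}" using cd ij by simp
      qed
      have "ennreal (\<Sum>i<n. d' i - c i) = (\<Sum>i<n. ennreal (d' i - c i))"
        using cd by (intro sum_ennreal[symmetric]) auto
      also have "\<dots> = (\<Sum>i<n. emeasure lebesgue {c i<..<d' i})"
        using cd by (intro sum.cong) auto
      also have "\<dots> = emeasure lebesgue (\<Union>i<n. {c i<..<d' i})"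
        by (intro sum_emeasure dis) auto
      also have "\<dots> \<le> emeasure lebesgue U"
        using cd U(1) by (intro emeasure_mono) auto
      also have "\<dots> < ennreal \<delta>" by fact
      finally have "(\<Sum>i<n. d' i - c i) < \<delta>"
        using cd by (subst (asm) ennreal_less_iff) (auto intro!: sum_nonneg)
      then have "(\<Sum>i<n. norm (z (d' i) - z (c i))) < e/2"
        using cd by (intro ac' dis) auto
      also have "(\<Sum>i<n. norm (z (d' i) - z (c i))) = (\<Sum>(x,K)\<in>p2. norm (z (Sup K) - z (Inf K)))"
        unfolding h'(2)[symmetric] by (subst sum.reindex[OF h'(1)]) (simp add: c_def d'_def split_beta)
      finally have 2: "(\<Sum>(x,K)\<in>p2. norm (z (Sup K) - z (Inf K))) < e/2" .
      have "norm (\<Sum>q\<in>p2. ?D q) \<le> (\<Sum>(x,K)\<in>p2. norm (z (Sup K) - z (Inf K)))"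
        by (rule sum_norm_le) (auto simp: p2_def f_def norm_minus_commute)
      with 2 have 2: "norm (\<Sum>q\<in>p2. ?D q) < e/2" by linarith
      have "(\<Sum>(x, k)\<in>p. measure lborel k *\<^sub>R f x) - (z 1 - z 0) = (\<Sum>q\<in>p. ?D q)"
        by (simp add: ba(2) sum_subtractf split_beta)
      also have "\<dots> = (\<Sum>q\<in>p1. ?D q) + (\<Sum>q\<in>p2. ?D q)"
        unfolding p12(1) by (rule sum.union_disjoint[OF p12(3,4,2)])
      finally show "norm ((\<Sum>(x, k)\<in>p. measure lborel k *\<^sub>R f x) - (z 1 - z 0)) < e"
        using norm_triangle_ineq[of "\<Sum>q\<in>p1. ?D q" "\<Sum>q\<in>p2. ?D q"] 1 2 e by simp
    qed
  qed
  then show ?thesis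
    by (rule has_integral_spike[OF N, rotated]) (simp add: f_def)
qed

text \<open>
  The Lebesgue differentiation theorem \<open>integrable_ccontinuous_explicit\<close> is about averages over
  \<open>[x, x + h]\<close>, that is, about the right derivative. Applied to the reflected function it also gives the left
  derivative.
\<close>

theorem indefinite_integral_has_vector_derivative_AE:
  fixes f :: "real \<Rightarrow> 'a::euclidean_space"
  assumes f: "f integrable_on {0..1}"
  shows "AE t in leb01. ((\<lambda>t. integral {0..t} f) has_vector_derivative f t) (at t within {0..1})"
proof -
  define g where "g t = (if t \<in> {0..1} then f t else 0)" for t
  have "g integrable_on UNIV"
    using f unfolding g_def by (subst integrable_restrict_UNIV)
  then have g: "g integrable_on cbox a b" for a b
    by (rule integrable_on_subcbox) simp
  have g': "(\<lambda>x. g (- x)) integrable_on cbox a b" for a b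
    using g[of "-b" "-a"] by (subst (asm) integrable_reflect[symmetric]) simp
  obtain N1 where N1: "negligible N1" 
       "\<And>x e. \<lbrakk>x \<notin> N1; 0 < e\<rbrakk> \<Longrightarrow> \<exists>d>0. \<forall>h. 0 < h \<and> h < d \<longrightarrow> norm(integral {x..x + h} g /\<^sub>R h - g x) < e"
    using integrable_ccontinuous_explicit[of g, OF g] by (auto simp: box_real)
  obtain N2 where N2: "negligible N2" 
       "\<And>x e. \<lbrakk>x \<notin> N2; 0 < e\<rbrakk> \<Longrightarrow> \<exists>d>0. \<forall>h. 0 < h \<and> h < d \<longrightarrow> norm(integral {x..x + h} (\<lambda>x. g (- x)) /\<^sub>R h - g (- x)) < e"
    using integrable_ccontinuous_explicit[of "\<lambda>x. g (- x)", OF g'] by (auto simp: box_real)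
  have N: "negligible (N1 \<union> uminus ` N2)"
    using N1(1) N2(1) by (intro negligible_Un negligible_locally_Lipschitz_image exI[of _ UNIV] exI[of _ 1]) (auto simp: norm_minus_commute)
  have scale: "norm (w - h *\<^sub>R v) \<le> e * h" if "0 < h" "norm (w /\<^sub>R h - v) < e" for w v :: 'a and h e
  proof -
    have "norm (w - h *\<^sub>R v) = norm (h *\<^sub>R (w /\<^sub>R h - v))" using that(1) by (simp add: scaleR_diff_right)
    also have "\<dots> = h * norm (w /\<^sub>R h - v)" using that(1) by simp
    also have "\<dots> \<le> h * e" using that by (intro mult_left_mono) auto
    finally show ?thesis by (simp add: mult.commute)
  qed
  have "((\<lambda>t. integral {0..t} f) has_vector_derivative f t) (at t within {0..1})"
    if t: "t \<in> {0..1} - (N1 \<union> uminus ` N2)" for t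
    unfolding has_vector_derivative_def has_derivative_within_alt
  proof (intro conjI allI impI)
    fix e :: real assume e: "e > 0"
    have "- t \<notin> N2" using t by force
    then obtain d2 where d2: "d2 > 0" "\<And>h. 0 < h \<Longrightarrow> h < d2 \<Longrightarrow> norm(integral {-t..-t + h} (\<lambda>x. g (- x)) /\<^sub>R h - g t) < e"
      using N2(2)[of "-t" e] e by auto
    obtain d1 where d1: "d1 > 0" "\<And>h. 0 < h \<Longrightarrow> h < d1 \<Longrightarrow> norm(integral {t..t + h} g /\<^sub>R h - g t) < e"
      using N1(2)[of t e] t e by auto
    have diff: "integral {0..v} f - integral {0..u} f = integral {u..v} g" if "0 \<le> u" "u \<le> v" "v \<le> 1" for u v
    proof -
      have "integral {0..u} f + integral {u..v} f = integral {0..v} f"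
        using that by (intro Henstock_Kurzweil_Integration.integral_combine integrable_on_subinterval[OF f]) auto
      moreover have "integral {u..v} f = integral {u..v} g"
        using that by (intro integral_cong) (simp add: g_def)
      ultimately show ?thesis by (simp add: algebra_simps)
    qed
    have "norm (integral {0..y} f - integral {0..t} f - (y - t) *\<^sub>R f t) \<le> e * norm (y - t)"
      if y: "y \<in> {0..1}" "norm (y - t) < min d1 d2" for y
    proof -
      consider "y = t" | "t < y" | "y < t" by linarith
      then show ?thesis
      proof cases
        case 2
        with scale[OF _ d1(2), of "y - t"] y t show ?thesis
          by (subst diff) (auto simp: g_def)
      next
        case 3
        have "integral {y..t} g = integral {-t..-y} (\<lambda>x. g (- x))"
          by (rule Henstock_Kurzweil_Integration.integral_reflect_real[symmetric])
        then have "norm (integral {y..t} g - (t - y) *\<^sub>R f t) \<le> e * (t - y)"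
          using scale[OF _ d2(2), of "t - y"] y t 3 by (auto simp: g_def)
        then have "norm (- (integral {0..t} f - integral {0..y} f - (t - y) *\<^sub>R f t)) \<le> e * (t - y)"
          using y t 3 by (subst norm_minus_cancel, subst diff) auto
        then show ?thesis using 3 by (simp add: algebra_simps)
      qed simp
    qed
    then show "\<exists>d>0. \<forall>y\<in>{0..1}. norm (y - t) < d \<longrightarrow>
        norm (integral {0..y} f - integral {0..t} f - (y - t) *\<^sub>R f t) \<le> e * norm (y - t)"
      using d1(1) d2(1) by (intro exI[of _ "min d1 d2"]) auto
  qed (intro bounded_linear_intros)
  with N show ?thesis unfolding AE_leb01_iff by blast
qed

section \<open>Square-integrable functions\<close>

lemma L2D: "f \<in> L2 \<Longrightarrow> f \<in> borel_measurable leb01" "f \<in> L2 \<Longrightarrow> integrable leb01 (\<lambda>t. (norm (f t))\<^sup>2)"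
  by (auto simp: L2_def)

lemma L2_dominated:
  fixes f :: "real \<Rightarrow> 'a::euclidean_space" and g :: "real \<Rightarrow> 'b::euclidean_space"
  assumes "g \<in> L2" and [measurable]: "f \<in> borel_measurable leb01"
    and le: "\<And>t. t \<in> {0..1} \<Longrightarrow> norm (f t) \<le> K * norm (g t)"
  shows "f \<in> L2"
proof -
  have "integrable leb01 (\<lambda>t. (norm (f t))\<^sup>2)"
  proof (rule Bochner_Integration.integrable_bound)
    show "integrable leb01 (\<lambda>t. K\<^sup>2 * (norm (g t))\<^sup>2)" using L2D(2)[OF assms(1)] by simp
    show "AE t in leb01. norm ((norm (f t))\<^sup>2) \<le> norm (K\<^sup>2 * (norm (g t))\<^sup>2)"
    proof (rule AE_I2)
      fix t assume "t \<in> space leb01"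
      then have "(norm (f t))\<^sup>2 \<le> (K * norm (g t))\<^sup>2" by (intro power_mono le) auto
      then show "norm ((norm (f t))\<^sup>2) \<le> norm (K\<^sup>2 * (norm (g t))\<^sup>2)" by (simp add: power_mult_distrib)
    qed
  qed simp
  then show ?thesis by (simp add: L2_def)
qed

lemma L2_add:
  assumes "f \<in> L2" "g \<in> L2" shows "(\<lambda>t. f t + g t) \<in> L2"
proof -
  have [measurable]: "f \<in> borel_measurable leb01" "g \<in> borel_measurable leb01" using assms by (auto intro: L2D)
  have "integrable leb01 (\<lambda>t. (norm (f t + g t))\<^sup>2)"
  proof (rule Bochner_Integration.integrable_bound)
    show "integrable leb01 (\<lambda>t. 2 * (norm (f t))\<^sup>2 + 2 * (norm (g t))\<^sup>2)"
      using L2D(2)[OF assms(1)] L2D(2)[OF assms(2)] by simp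
    have "(norm (f t + g t))\<^sup>2 \<le> 2 * (norm (f t))\<^sup>2 + 2 * (norm (g t))\<^sup>2" for t
    proof -
      have "(norm (f t + g t))\<^sup>2 \<le> (norm (f t) + norm (g t))\<^sup>2" by (intro power_mono norm_triangle_ineq) simp
      also have "\<dots> \<le> 2 * (norm (f t))\<^sup>2 + 2 * (norm (g t))\<^sup>2"
        using zero_le_power2[of "norm (f t) - norm (g t)"] by (simp add: power2_eq_square algebra_simps)
      finally show ?thesis .
    qed
    then show "AE t in leb01. norm ((norm (f t + g t))\<^sup>2) \<le> norm (2 * (norm (f t))\<^sup>2 + 2 * (norm (g t))\<^sup>2)"
      by simp
  qed simp
  then show ?thesis by (simp add: L2_def)
qed

lemma L2_scaleR: "f \<in> L2 \<Longrightarrow> (\<lambda>t. c *\<^sub>R f t) \<in> L2"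
  by (rule L2_dominated[of f _ "\<bar>c\<bar>"]) (auto dest: L2D)

lemma L2_diff: "f \<in> L2 \<Longrightarrow> g \<in> L2 \<Longrightarrow> (\<lambda>t. f t - g t) \<in> L2"
  using L2_add[OF _ L2_scaleR[of g "-1"]] by simp

lemma L2_continuous: 
  fixes f :: "real \<Rightarrow> 'a::euclidean_space"
  shows "continuous_on {0..1} f \<Longrightarrow> f \<in> L2"
  unfolding L2_def
  by (auto intro!: continuous_imp_measurable_on_sets_lebesgue continuous_imp_integrable_real continuous_intros)

lemma L2_scaleR_continuous:
  assumes u: "u \<in> L2" and g: "continuous_on {0..1} g"
  shows "(\<lambda>t. u t *\<^sub>R g t :: 'a::euclidean_space) \<in> L2"
proof -
  obtain B where B: "\<And>t. t \<in> {0..1} \<Longrightarrow> norm (g t) \<le> B"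
    using continuous_on_bounded01[OF g] by blast
  have [measurable]: "u \<in> borel_measurable leb01" "g \<in> borel_measurable leb01" 
    using assms by (auto intro: L2D L2_continuous)
  show ?thesis
    by (rule L2_dominated[OF u, of _ B]) (use B in \<open>auto simp: mult.commute[of B] mult_left_mono\<close>)
qed

lemma L2_scaleR_integrable:
  fixes f :: "real \<Rightarrow> real" and g :: "real \<Rightarrow> 'a::euclidean_space"
  assumes "f \<in> L2" "g \<in> L2"
  shows "integrable leb01 (\<lambda>t. f t *\<^sub>R g t)"
proof (rule Bochner_Integration.integrable_bound)
  have [measurable]: "f \<in> borel_measurable leb01" "g \<in> borel_measurable leb01" using assms by (auto intro: L2D)
  show "(\<lambda>t. f t *\<^sub>R g t) \<in> borel_measurable leb01" by measurable
  show "integrable leb01 (\<lambda>t. (norm (f t))\<^sup>2 + (norm (g t))\<^sup>2)"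
    using L2D(2)[OF assms(1)] L2D(2)[OF assms(2)] by simp
  have "\<bar>f t\<bar> * norm (g t) \<le> (norm (f t))\<^sup>2 + (norm (g t))\<^sup>2" for t
  proof -
    have "2 * (\<bar>f t\<bar> * norm (g t)) \<le> (norm (f t))\<^sup>2 + (norm (g t))\<^sup>2"
      using zero_le_power2[of "\<bar>f t\<bar> - norm (g t)"] by (simp add: power2_eq_square algebra_simps)
    moreover have "0 \<le> \<bar>f t\<bar> * norm (g t)" by simp
    ultimately show ?thesis by linarith
  qed
  then show "AE t in leb01. norm (f t *\<^sub>R g t) \<le> norm ((norm (f t))\<^sup>2 + (norm (g t))\<^sup>2)"
    by (auto simp: abs_mult)
qed

lemma L2_mult_integrable: "f \<in> L2 \<Longrightarrow> g \<in> L2 \<Longrightarrow> integrable leb01 (\<lambda>t. f t * g t :: real)"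
  using L2_scaleR_integrable[of f g] by simp

lemma L2_power2_integrable: "f \<in> L2 \<Longrightarrow> integrable leb01 (\<lambda>t. (f t :: real)\<^sup>2)"
  using L2D(2)[of f] by simp

lemma L2_imp_integrable: "f \<in> L2 \<Longrightarrow> integrable leb01 f"
  using L2_scaleR_integrable[OF L2_continuous[of "\<lambda>_. 1"], of f] by simp

text \<open>
  For every \<open>\<eta> > 0\<close>, the inequality \<open>|f| \<le> \<eta>/2 |f|\<^sup>2 + 1/(2\<eta>)\<close> bounds the increments over
  disjoint intervals of total length less than \<open>\<delta>\<close> by \<open>\<eta>/2 \<integral>|f|\<^sup>2 + \<delta>/(2\<eta>)\<close>. With \<open>\<eta> = \<epsilon> / (\<integral>|f|\<^sup>2 + 1)\<close>
  and \<open>\<delta> = \<eta> \<epsilon>\<close> this is less than \<open>\<epsilon>\<close>.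
\<close>

lemma abs_cont01_indefinite_integral:
  fixes f :: "real \<Rightarrow> 'a::euclidean_space"
  assumes f: "f \<in> L2"
  shows "abs_cont01 (\<lambda>t. x0 + integral {0..t} f)"
proof -
  define q where "q t = (norm (f t))\<^sup>2" for t
  have q: "q integrable_on {0..1}"
    unfolding q_def by (rule integrable_on_lebesgue_on[OF L2D(2)[OF f]]) simp
  have fint: "f integrable_on {0..1}"
    by (rule integrable_on_lebesgue_on[OF L2_imp_integrable[OF f]]) simp
  define S where "S = integral {0..1} q"
  have S: "S \<ge> 0" unfolding S_def by (rule Henstock_Kurzweil_Integration.integral_nonneg[OF q]) (simp add: q_def)
  show ?thesis
    unfolding abs_cont01_def
  proof (intro allI impI)
    fix \<epsilon> :: real assume e: "\<epsilon> > 0"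
    define \<eta> where "\<eta> = \<epsilon> / (S + 1)"
    have \<eta>: "\<eta> > 0" using e S by (simp add: \<eta>_def)
    show "\<exists>\<delta>>0. \<forall>(n::nat) c d.
        (\<forall>i<n. 0 \<le> c i \<and> c i \<le> d i \<and> d i \<le> 1) \<and>
        disjoint_family_on (\<lambda>i. {c i<..<d i}) {..<n} \<and>
        (\<Sum>i<n. d i - c i) < \<delta>
        \<longrightarrow> (\<Sum>i<n. norm ((x0 + integral {0..d i} f) - (x0 + integral {0..c i} f))) < \<epsilon>"
    proof (intro exI[of _ "\<eta> * \<epsilon>"] conjI allI impI; (elim conjE)?)
      fix n and c d :: "nat \<Rightarrow> real"
      assume cd: "\<forall>i<n. 0 \<le> c i \<and> c i \<le> d i \<and> d i \<le> 1" 
        and dis: "disjoint_family_on (\<lambda>i. {c i<..<d i}) {..<n}"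
        and s: "(\<Sum>i<n. d i - c i) < \<eta> * \<epsilon>"
      have step: "norm ((x0 + integral {0..d i} f) - (x0 + integral {0..c i} f)) 
           \<le> \<eta>/2 * integral {c i..d i} q + (d i - c i) / (2 * \<eta>)" if "i < n" for i
      proof -
        have i: "0 \<le> c i" "c i \<le> d i" "d i \<le> 1" using cd that by auto
        then have sub: "{c i..d i} \<subseteq> {0..1}" by auto
        note qi = integrable_on_subinterval[OF q sub] and fi = integrable_on_subinterval[OF fint sub]
        have qi': "(\<lambda>t. \<eta>/2 * q t) integrable_on {c i..d i}"
          using integrable_on_cmult_left[OF qi, of "\<eta>/2"] by simp
        have "integral {0..c i} f + integral {c i..d i} f = integral {0..d i} f"
          using i by (intro Henstock_Kurzweil_Integration.integral_combine integrable_on_subinterval[OF fint]) auto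
        then have "integral {0..d i} f - integral {0..c i} f = integral {c i..d i} f"
          by (metis add_diff_cancel_left')
        then have "norm ((x0 + integral {0..d i} f) - (x0 + integral {0..c i} f)) = norm (integral {c i..d i} f)"
          by simp
        also have "\<dots> \<le> integral {c i..d i} (\<lambda>t. \<eta>/2 * q t + 1 / (2 * \<eta>))"
        proof (rule integral_norm_bound_integral[OF fi])
          show "(\<lambda>t. \<eta>/2 * q t + 1 / (2 * \<eta>)) integrable_on {c i..d i}"
            by (intro integrable_add qi' integrable_const_ivl)
          show "norm (f t) \<le> \<eta>/2 * q t + 1 / (2 * \<eta>)" for t
          proof -
            have "0 \<le> (\<eta> * norm (f t) - 1)\<^sup>2" by simp
            then show ?thesis using \<eta> by (simp add: q_def field_simps power2_eq_square)
          qed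
        qed
        also have "\<dots> = \<eta>/2 * integral {c i..d i} q + (d i - c i) / (2 * \<eta>)"
          using i by (subst Henstock_Kurzweil_Integration.integral_add[OF qi' integrable_const_ivl]) simp
        finally show ?thesis .
      qed
      let ?r = "\<lambda>i t. if t \<in> {c i<..<d i} then q t else 0"
      have r: "(?r i has_integral integral {c i..d i} q) {0..1}" if "i < n" for i
      proof -
        have sub: "{c i<..<d i} \<subseteq> {0..1}" "{c i..d i} \<subseteq> {0..1}" using cd that by force+
        have "(q has_integral integral {c i<..<d i} q) {c i<..<d i}"
          using integrable_on_subinterval[OF q sub(2)] 
          by (simp add: integrable_on_open_interval_real has_integral_integral[symmetric])
        then show ?thesis using sub(1) by (simp only: has_integral_restrict integral_open_interval_real)
      qed
      \<comment> \<open>Distribute the integrals over the disjoint intervals into one integral over \<open>[0,1]\<close>.\<close>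
      have q_le: "(\<Sum>i<n. integral {c i..d i} q) \<le> S"
      proof (rule has_integral_le)
        show "((\<lambda>t. \<Sum>i<n. ?r i t) has_integral (\<Sum>i<n. integral {c i..d i} q)) {0..1}"
          by (intro has_integral_sum r) auto
        show "(q has_integral S) {0..1}" using q by (simp add: S_def has_integral_integral[symmetric])
        fix t
        show "(\<Sum>i<n. ?r i t) \<le> q t"
        proof (cases "\<exists>j<n. t \<in> {c j<..<d j}")
          case True
          then obtain j where j: "j < n" "t \<in> {c j<..<d j}" by blast
          have "?r i t = 0" if "i \<in> {..<n} - {j}" for i
          proof -
            have "{c i<..<d i} \<inter> {c j<..<d j} = {}"
              using dis j(1) that unfolding disjoint_family_on_def by simp
            then show ?thesis using j(2) by auto
          qed
          then have "(\<Sum>i<n. ?r i t) = (\<Sum>i\<in>{j}. ?r i t)"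
            using j by (intro sum.mono_neutral_right) auto
          then show ?thesis using j by simp
        next
          case False
          then have "(\<Sum>i<n. ?r i t) = 0" by (intro sum.neutral) auto
          then show ?thesis by (simp add: q_def)
        qed
      qed
      have "(\<Sum>i<n. norm ((x0 + integral {0..d i} f) - (x0 + integral {0..c i} f)))
         \<le> (\<Sum>i<n. \<eta>/2 * integral {c i..d i} q + (d i - c i) / (2 * \<eta>))"
        by (intro sum_mono step) auto
      also have "\<dots> = \<eta>/2 * (\<Sum>i<n. integral {c i..d i} q) + (\<Sum>i<n. d i - c i) / (2 * \<eta>)"
        by (simp add: sum.distrib sum_distrib_left sum_divide_distrib)
      also have "\<dots> < \<eta>/2 * (S + 1) + \<eta> * \<epsilon> / (2 * \<eta>)"
        using \<eta> s q_le by (intro add_strict_mono mult_strict_left_mono divide_strict_right_mono) auto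
      also have "\<dots> = \<eta> * (S + 1) / 2 + \<epsilon> / 2" using \<eta> by simp
      also have "\<eta> * (S + 1) = \<epsilon>" using S by (simp add: \<eta>_def)
      also have "\<epsilon> / 2 + \<epsilon> / 2 = \<epsilon>" by simp
      finally show "(\<Sum>i<n. norm ((x0 + integral {0..d i} f) - (x0 + integral {0..c i} f))) < \<epsilon>" .
    qed (use e \<eta> in auto)
  qed
qed

section \<open>Reachability as a finite system of moment equations\<close>

lemma adjoint_solutionD:
  assumes "adjoint_solution A p"
  shows "abs_cont01 p" "continuous_on {0..1} p"
    "t \<in> {0..1} \<Longrightarrow> (p has_vector_derivative (- (transpose (A t) *v p t))) (at t within {0..1})"
  using assms by (auto simp: adjoint_solution_def W12_def intro: abs_cont01_imp_continuous_on)

lemma adjoint_solutionI: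
  fixes A :: "real \<Rightarrow> real^'n^'n"
  assumes A: "continuous_on {0..1} A"
    and deriv: "\<And>t. t \<in> {0..1} \<Longrightarrow> (p has_vector_derivative (- (transpose (A t) *v p t))) (at t within {0..1})"
  shows "adjoint_solution A p"
proof -
  have p: "continuous_on {0..1} p" by (rule has_vector_derivative_imp_continuous_on[OF deriv])
  have p': "continuous_on {0..1} (\<lambda>t. - (transpose (A t) *v p t))"
    by (intro continuous_intros bounded_bilinear.continuous_on[OF bounded_bilinear_matrix_vector_mult]
        bounded_linear.continuous_on[OF bounded_linear_transpose] A p)
  have "p \<in> W12"
    unfolding W12_def using abs_cont01_if_bounded_derivative[OF deriv p'] L2_continuous[OF p] L2_continuous[OF p'] deriv
    by (auto intro!: bexI[of _ "\<lambda>t. - (transpose (A t) *v p t)"])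
  with deriv show ?thesis by (simp add: adjoint_solution_def)
qed

text \<open>
  The terms with \<open>A\<close> cancel in the derivative of \<open>p \<bullet> x\<close>, which leaves \<open>(b \<bullet> p) u\<close>. Since \<open>x\<close> is only
  differentiable almost everywhere, integrating this uses that \<open>p \<bullet> x\<close> is absolutely continuous.
\<close>

theorem setA_adjoint_pairing:
  fixes A :: "real \<Rightarrow> real^'n^'n"
  assumes b: "continuous_on {0..1} b" and u: "u \<in> setA A b x0 xf" and p: "adjoint_solution A p"
  shows "(\<integral>t. (b t \<bullet> p t) * u t \<partial>leb01) = xf \<bullet> p 1 - x0 \<bullet> p 0"
proof -
  from u obtain x where uL: "u \<in> L2" and xW: "x \<in> W12" and x01: "x 0 = x0" "x 1 = xf"
    and dx: "AE t in leb01. (x has_vector_derivative (A t *v x t + u t *\<^sub>R b t)) (at t within {0..1})"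
    by (auto simp: setA_def)
  note p' = adjoint_solutionD[OF p]
  have "abs_cont01 (\<lambda>t. p t \<bullet> x t)"
    by (rule abs_cont01_bilinear[OF bounded_bilinear_inner p'(1)]) (use xW in \<open>simp add: W12_def\<close>)
  moreover have "AE t in leb01. ((\<lambda>t. p t \<bullet> x t) has_vector_derivative ((b t \<bullet> p t) * u t)) (at t within {0..1})"
    using dx AE_space
  proof eventually_elim
    case (elim t)
    then have "t \<in> {0..1}" by simp
    from has_vector_derivative_bilinear[OF bounded_bilinear_inner p'(3)[OF this] elim(1)]
    moreover have "p t \<bullet> (A t *v x t + u t *\<^sub>R b t) + (- (transpose (A t) *v p t)) \<bullet> x t = (b t \<bullet> p t) * u t"
      by (simp add: inner_add_right dot_lmul_matrix inner_commute[of "b t"] mult.commute)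
    ultimately show ?case by simp
  qed
  ultimately have "((\<lambda>t. (b t \<bullet> p t) * u t) has_integral (p 1 \<bullet> x 1 - p 0 \<bullet> x 0)) {0..1}"
    by (rule abs_cont01_has_integral_derivative)
  moreover have "integrable leb01 (\<lambda>t. (b t \<bullet> p t) * u t)"
    by (intro L2_mult_integrable L2_continuous uL continuous_intros b p')
  then have "((\<lambda>t. (b t \<bullet> p t) * u t) has_integral (\<integral>t. (b t \<bullet> p t) * u t \<partial>leb01)) {0..1}"
    by (rule has_integral_integral_lebesgue_on) simp
  ultimately have "(\<integral>t. (b t \<bullet> p t) * u t \<partial>leb01) = p 1 \<bullet> x 1 - p 0 \<bullet> x 0"
    using has_integral_unique by blast
  then show ?thesis by (simp add: x01 inner_commute)
qed

text \<open>
  The trajectory is \<open>x(t) = \<Phi>(t) (x\<^sub>0 + \<integral>\<^sub>0\<^sup>t u P\<^sup>T b)\<close>, since \<open>P\<^sup>T\<close> is the inverse of \<open>\<Phi>\<close>; the moment condition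
  is exactly what makes it end at \<open>x\<^sub>f\<close>.
\<close>

lemma setA_variation_of_constants:
  fixes A :: "real \<Rightarrow> real^'n^'n"
  assumes A: "continuous_on {0..1} A" and b: "continuous_on {0..1} b" and u: "u \<in> L2"
    and \<Phi>0: "\<Phi> 0 = mat 1"
    and \<Phi>: "\<And>t. t \<in> {0..1} \<Longrightarrow> (\<Phi> has_vector_derivative A t ** \<Phi> t) (at t within {0..1})"
    and P: "continuous_on {0..1} P"
    and inv: "\<And>t. t \<in> {0..1} \<Longrightarrow> \<Phi> t ** transpose (P t) = mat 1"
    and moment: "(\<integral>t. u t *\<^sub>R (transpose (P t) *v b t) \<partial>leb01) = transpose (P 1) *v xf - x0"
  shows "u \<in> setA A b x0 xf"
proof -
  define h where "h t = u t *\<^sub>R (transpose (P t) *v b t)" for t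
  have h: "h \<in> L2"
    unfolding h_def
    by (intro L2_scaleR_continuous u bounded_bilinear.continuous_on[OF bounded_bilinear_matrix_vector_mult]
        bounded_linear.continuous_on[OF bounded_linear_transpose] b P)
  have hint: "h integrable_on {0..1}"
    by (rule integrable_on_lebesgue_on[OF L2_imp_integrable[OF h]]) simp
  define H where "H t = x0 + integral {0..t} h" for t
  define x where "x t = \<Phi> t *v H t" for t
  have \<Phi>c: "continuous_on {0..1} \<Phi>" by (rule has_vector_derivative_imp_continuous_on[OF \<Phi>])
  have "abs_cont01 H" unfolding H_def by (rule abs_cont01_indefinite_integral[OF h])
  moreover have "continuous_on {0..1} (\<lambda>t. A t ** \<Phi> t)"
    by (intro bounded_bilinear.continuous_on[OF bounded_bilinear_matrix_matrix_mult] A \<Phi>c)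
  then have "abs_cont01 \<Phi>" using abs_cont01_if_bounded_derivative[OF \<Phi>] by blast
  ultimately have xac: "abs_cont01 x"
    unfolding x_def by (intro abs_cont01_bilinear[OF bounded_bilinear_matrix_vector_mult])
  then have xc: "continuous_on {0..1} x" by (rule abs_cont01_imp_continuous_on)
  have dx: "AE t in leb01. (x has_vector_derivative (A t *v x t + u t *\<^sub>R b t)) (at t within {0..1})"
    using indefinite_integral_has_vector_derivative_AE[OF hint] AE_space
  proof eventually_elim
    case (elim t)
    then have t: "t \<in> {0..1}" by simp
    have "(H has_vector_derivative h t) (at t within {0..1})"
      using has_vector_derivative_add[OF has_vector_derivative_const elim(1), of x0] by (simp add: H_def[abs_def])
    from has_vector_derivative_bilinear[OF bounded_bilinear_matrix_vector_mult \<Phi>[OF t] this]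
    have "(x has_vector_derivative (\<Phi> t *v h t + (A t ** \<Phi> t) *v H t)) (at t within {0..1})"
      unfolding x_def .
    moreover have "\<Phi> t *v h t = u t *\<^sub>R b t"
      by (simp add: h_def matrix_vector_mult_scaleR matrix_vector_mul_assoc inv[OF t] del: transpose_matrix_vector)
    ultimately show ?case
      by (simp add: x_def matrix_vector_mul_assoc add.commute)
  qed
  have "(\<lambda>t. A t *v x t + u t *\<^sub>R b t) \<in> L2"
    by (intro L2_add L2_continuous L2_scaleR_continuous u b A xc bounded_bilinear.continuous_on[OF bounded_bilinear_matrix_vector_mult])
  then have "x \<in> W12"
    unfolding W12_def using xac dx L2_continuous[OF xc]
    by (intro CollectI conjI bexI[of _ "\<lambda>t. A t *v x t + u t *\<^sub>R b t"])
  moreover have "x 0 = x0" by (simp add: x_def H_def \<Phi>0)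
  moreover have "x 1 = xf"
  proof -
    have "integral {0..1} h = (\<integral>t. h t \<partial>leb01)"
      by (rule lebesgue_integral_eq_integral[symmetric, OF L2_imp_integrable[OF h]]) simp
    then have "H 1 = transpose (P 1) *v xf" using moment by (simp add: H_def h_def del: transpose_matrix_vector)
    then show ?thesis by (simp add: x_def matrix_vector_mul_assoc inv del: transpose_matrix_vector)
  qed
  ultimately show ?thesis using u dx unfolding setA_def by blast
qed

text \<open>
  The moment function is \<open>g = P\<^sup>T b\<close>. Pairing with the adjoint solution \<open>P c\<close>, for all \<open>c\<close>, shows that the moments
  are necessary; variation of constants shows that they are sufficient. The last clause identifies the
  combinations of the components of \<open>g\<close> as the functions \<open>b \<bullet> p\<close> with \<open>p\<close> adjoint.
\<close>

theorem setA_characterization: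
  fixes A :: "real \<Rightarrow> real^'n^'n"
  assumes A: "continuous_on {0..1} A" and b: "continuous_on {0..1} b"
  obtains g :: "real \<Rightarrow> real^'n" and \<xi> where "continuous_on {0..1} g"
    and "setA A b x0 xf = {u \<in> L2. (\<integral>t. u t *\<^sub>R g t \<partial>leb01) = \<xi>}"
    and "\<And>c. \<exists>p. adjoint_solution A p \<and> (\<forall>t. b t \<bullet> p t = g t \<bullet> c)"
proof -
  obtain \<Phi> P where \<Phi>P: "\<Phi> 0 = mat 1" "P 0 = mat 1"
    and d\<Phi>: "\<And>t. t \<in> {0..1} \<Longrightarrow> (\<Phi> has_vector_derivative A t ** \<Phi> t) (at t within {0..1})"
    and dP: "\<And>t. t \<in> {0..1} \<Longrightarrow> (P has_vector_derivative (- transpose (A t)) ** P t) (at t within {0..1})"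
    and inv: "\<And>t. t \<in> {0..1} \<Longrightarrow> \<Phi> t ** transpose (P t) = mat 1"
    by (rule fundamental_matrices_exist[OF A]) (rule that, assumption, assumption, simp_all)
  have Pc: "continuous_on {0..1} P" by (rule has_vector_derivative_imp_continuous_on[OF dP])
  define g where "g t = transpose (P t) *v b t" for t
  have g: "continuous_on {0..1} g"
    unfolding g_def
    by (intro bounded_bilinear.continuous_on[OF bounded_bilinear_matrix_vector_mult]
        bounded_linear.continuous_on[OF bounded_linear_transpose] b Pc)
  have adj: "adjoint_solution A (\<lambda>t. P t *v c)" for c
  proof (rule adjoint_solutionI[OF A])
    fix t :: real assume "t \<in> {0..1}"
    from bounded_linear.has_vector_derivative[OF bounded_bilinear.bounded_linear_left[OF bounded_bilinear_matrix_vector_mult] dP[OF this]]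
    have "((\<lambda>t. P t *v c) has_vector_derivative ((- transpose (A t)) ** P t) *v c) (at t within {0..1})" .
    then show "((\<lambda>t. P t *v c) has_vector_derivative - (transpose (A t) *v (P t *v c))) (at t within {0..1})"
      by (simp add: matrix_vector_mul_assoc[symmetric] bounded_bilinear.minus_left[OF bounded_bilinear_matrix_vector_mult])
  qed
  have bg: "b t \<bullet> (P t *v c) = g t \<bullet> c" for t c
    by (simp add: g_def dot_lmul_matrix)
  have "u \<in> setA A b x0 xf \<longleftrightarrow> u \<in> L2 \<and> (\<integral>t. u t *\<^sub>R g t \<partial>leb01) = transpose (P 1) *v xf - x0" for u
  proof
    assume u: "u \<in> setA A b x0 xf"
    then have uL: "u \<in> L2" by (simp add: setA_def)
    have int: "integrable leb01 (\<lambda>t. u t *\<^sub>R g t)"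
      by (intro L2_scaleR_integrable uL L2_continuous g)
    have "(\<integral>t. u t *\<^sub>R g t \<partial>leb01) \<bullet> c = (transpose (P 1) *v xf - x0) \<bullet> c" for c
    proof -
      have "(\<integral>t. u t *\<^sub>R g t \<partial>leb01) \<bullet> c = (\<integral>t. (b t \<bullet> (P t *v c)) * u t \<partial>leb01)"
        by (subst integral_inner_left[symmetric]) (use int in \<open>simp_all add: bg mult.commute\<close>)
      also have "\<dots> = xf \<bullet> (P 1 *v c) - x0 \<bullet> (P 0 *v c)"
        by (rule setA_adjoint_pairing[OF b u adj])
      finally show ?thesis by (simp add: \<Phi>P inner_diff_left dot_lmul_matrix)
    qed
    then show "u \<in> L2 \<and> (\<integral>t. u t *\<^sub>R g t \<partial>leb01) = transpose (P 1) *v xf - x0"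
      using uL by (metis vector_eq_rdot)
  next
    assume "u \<in> L2 \<and> (\<integral>t. u t *\<^sub>R g t \<partial>leb01) = transpose (P 1) *v xf - x0"
    then show "u \<in> setA A b x0 xf"
      using setA_variation_of_constants[OF A b _ \<Phi>P(1) d\<Phi> Pc inv] by (simp add: g_def)
  qed
  then show thesis by (intro that[OF g]) (use adj bg in blast)+
qed

section \<open>The two projections\<close>

text \<open>
  The Pythagorean inequality says that \<open>z\<close> is a nearest point of \<open>C\<close> with a quadratic
  margin. Hence a nearest point exists, so that the choice in \<open>proj\<close> is a proper one, and any two of
  them agree almost everywhere.
\<close>

lemma proj_eq_AE:
  assumes C: "C \<subseteq> L2" and v: "v \<in> L2" and z: "z \<in> C"
    and pyth: "\<And>c. c \<in> C \<Longrightarrow>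
      (\<integral>t. (v t - z t)\<^sup>2 \<partial>leb01) + (\<integral>t. (c t - z t)\<^sup>2 \<partial>leb01) \<le> (\<integral>t. (v t - c t)\<^sup>2 \<partial>leb01)"
  shows "proj C v \<in> C" and "AE t in leb01. proj C v t = z t"
proof -
  define y where "y = proj C v"
  have norm: "L2_norm (\<lambda>t. v t - c t) = sqrt (\<integral>t. (v t - c t)\<^sup>2 \<partial>leb01)" for c
    by (simp add: L2_norm_def)
  have "(\<integral>t. (v t - z t)\<^sup>2 \<partial>leb01) \<le> (\<integral>t. (v t - c t)\<^sup>2 \<partial>leb01)" if "c \<in> C" for c
  proof -
    have "0 \<le> (\<integral>t. (c t - z t)\<^sup>2 \<partial>leb01)" by (rule Bochner_Integration.integral_nonneg) simp
    with pyth[OF that] show ?thesis by linarith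
  qed
  then have "z \<in> C \<and> (\<forall>c\<in>C. L2_norm (\<lambda>t. v t - z t) \<le> L2_norm (\<lambda>t. v t - c t))"
    using z by (simp add: norm)
  then have y: "y \<in> C \<and> (\<forall>c\<in>C. L2_norm (\<lambda>t. v t - y t) \<le> L2_norm (\<lambda>t. v t - c t))"
    unfolding y_def proj_def
    by (rule someI[where P = "\<lambda>u. u \<in> C \<and> (\<forall>c\<in>C. L2_norm (\<lambda>t. v t - u t) \<le> L2_norm (\<lambda>t. v t - c t))"])
  then have "(\<integral>t. (v t - y t)\<^sup>2 \<partial>leb01) \<le> (\<integral>t. (v t - z t)\<^sup>2 \<partial>leb01)"
    using z by (auto simp: norm)
  with pyth[of y] y have "(\<integral>t. (y t - z t)\<^sup>2 \<partial>leb01) \<le> 0" by auto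
  moreover have "0 \<le> (\<integral>t. (y t - z t)\<^sup>2 \<partial>leb01)" by (rule Bochner_Integration.integral_nonneg) simp
  ultimately have "(\<integral>t. (y t - z t)\<^sup>2 \<partial>leb01) = 0" by linarith
  moreover have "integrable leb01 (\<lambda>t. (y t - z t)\<^sup>2)"
    using y z C by (intro L2_power2_integrable L2_diff) auto
  ultimately have "AE t in leb01. (y t - z t)\<^sup>2 = 0"
    by (subst (asm) integral_nonneg_eq_0_iff_AE) auto
  then show "proj C v \<in> C" "AE t in leb01. proj C v t = z t"
    using y by (simp_all add: y_def)
qed

text \<open>
  The obtuse angle property of the projection on an interval: the three scalar uses of clamping
  below (the projection on the box, the growth of the primal cost, the bound on \<open>\<vartheta>\<close>) all rest on it.
\<close>

lemma clamp_variational: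
  fixes v lo hi c :: real
  assumes "lo \<le> c" "c \<le> hi"
  shows "(v - max lo (min hi v)) * (c - max lo (min hi v)) \<le> 0"
proof -
  consider "v < lo" | "lo \<le> v" "v \<le> hi" | "hi < v" by linarith
  then show ?thesis
  proof cases
    case 1
    then have "max lo (min hi v) = lo" using assms by simp
    then show ?thesis using 1 assms by (simp add: mult_nonpos_nonneg)
  next
    case 2
    then show ?thesis by simp
  next
    case 3
    then have "max lo (min hi v) = hi" using assms by simp
    then show ?thesis using 3 assms by (simp add: mult_nonneg_nonpos)
  qed
qed

theorem proj_setB:
  assumes alo: "continuous_on {0..1} alo" and ahi: "continuous_on {0..1} ahi"
    and le: "\<And>t. t \<in> {0..1} \<Longrightarrow> alo t \<le> ahi t" and v: "v \<in> L2"
  shows "proj (setB alo ahi) v \<in> setB alo ahi"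
    and "AE t in leb01. proj (setB alo ahi) v t = max (alo t) (min (ahi t) (v t))"
proof -
  define z where "z t = max (alo t) (min (ahi t) (v t))" for t
  have [measurable]: "v \<in> borel_measurable leb01" "alo \<in> borel_measurable leb01" "ahi \<in> borel_measurable leb01"
    using v alo ahi by (auto intro: L2D L2_continuous)
  obtain B1 B2 where B: "\<And>t. t \<in> {0..1} \<Longrightarrow> norm (alo t) \<le> B1" "\<And>t. t \<in> {0..1} \<Longrightarrow> norm (ahi t) \<le> B2"
    using continuous_on_bounded01[OF alo] continuous_on_bounded01[OF ahi] by metis
  have zL: "z \<in> L2"
  proof (rule L2_dominated[OF L2_continuous[of "\<lambda>_. B1 + B2"], of z 1])
    show "norm (z t) \<le> 1 * norm (B1 + B2)" if "t \<in> {0..1}" for t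
      using B[OF that] le[OF that] by (auto simp: z_def)
  qed (auto simp: z_def[abs_def])
  have z: "z \<in> setB alo ahi"
    unfolding setB_def using zL le by (auto simp: z_def intro!: AE_I2)
  have pyth: "(\<integral>t. (v t - z t)\<^sup>2 \<partial>leb01) + (\<integral>t. (c t - z t)\<^sup>2 \<partial>leb01) \<le> (\<integral>t. (v t - c t)\<^sup>2 \<partial>leb01)"
    if c: "c \<in> setB alo ahi" for c
  proof -
    have cL: "c \<in> L2" and cb: "AE t in leb01. alo t \<le> c t \<and> c t \<le> ahi t" using c by (auto simp: setB_def)
    have int: "integrable leb01 (\<lambda>t. (v t - z t)\<^sup>2)" "integrable leb01 (\<lambda>t. (c t - z t)\<^sup>2)"
      "integrable leb01 (\<lambda>t. (v t - c t)\<^sup>2)"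
      by (intro L2_power2_integrable L2_diff v zL cL)+
    have "(\<integral>t. (v t - z t)\<^sup>2 + (c t - z t)\<^sup>2 \<partial>leb01) \<le> (\<integral>t. (v t - c t)\<^sup>2 \<partial>leb01)"
    proof (rule integral_mono_AE)
      show "AE t in leb01. (v t - z t)\<^sup>2 + (c t - z t)\<^sup>2 \<le> (v t - c t)\<^sup>2"
        using cb
      proof eventually_elim
        case (elim t)
        have "(v t - c t)\<^sup>2 = (v t - z t)\<^sup>2 + (c t - z t)\<^sup>2 - 2 * ((v t - z t) * (c t - z t))"
          by (simp add: power2_eq_square algebra_simps)
        moreover have "(v t - z t) * (c t - z t) \<le> 0"
          unfolding z_def by (rule clamp_variational) (use elim in auto)
        ultimately show ?case by linarith
      qed
    qed (use int in auto)
    then show ?thesis using int by simp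
  qed
  show "proj (setB alo ahi) v \<in> setB alo ahi"
    and "AE t in leb01. proj (setB alo ahi) v t = max (alo t) (min (ahi t) (v t))"
    using proj_eq_AE[OF _ v z pyth] by (auto simp: setB_def z_def)
qed

text \<open>
  The range of the Gram operator \<open>c \<mapsto> \<integral> (g \<bullet> c) g\<close> contains every moment vector, even if it
  is singular: a vector \<open>z\<close> orthogonal to the range has \<open>\<integral> (g \<bullet> z)\<^sup>2 = 0\<close>, so \<open>g \<bullet> z\<close> vanishes almost everywhere
  and \<open>z\<close> is orthogonal to all moments.
\<close>

lemma gram_range:
  fixes g :: "real \<Rightarrow> real^'n"
  assumes g: "continuous_on {0..1} g" and h: "h \<in> L2"
  obtains c where "(\<integral>t. (g t \<bullet> c) *\<^sub>R g t \<partial>leb01) = (\<integral>t. h t *\<^sub>R g t \<partial>leb01)"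
proof -
  define G where "G c = (\<integral>t. (g t \<bullet> c) *\<^sub>R g t \<partial>leb01)" for c
  define y where "y = (\<integral>t. h t *\<^sub>R g t \<partial>leb01)"
  have gL: "g \<in> L2" by (rule L2_continuous[OF g])
  have gc: "(\<lambda>t. g t \<bullet> c) \<in> L2" for c by (intro L2_continuous continuous_intros g)
  have int: "integrable leb01 (\<lambda>t. (g t \<bullet> c) *\<^sub>R g t)" for c by (intro L2_scaleR_integrable gL gc)
  have "linear G"
  proof (rule linearI)
    show "G (c + d) = G c + G d" for c d
      unfolding G_def using Bochner_Integration.integral_add[OF int[of c] int[of d]]
      by (simp add: inner_add_right scaleR_add_left)
    show "G (a *\<^sub>R c) = a *\<^sub>R G c" for a c
      by (simp add: G_def scaleR_scaleR[symmetric] del: scaleR_scaleR)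
  qed
  then have span: "span (range G) = range G"
    by (simp add: linear_subspace_image span_eq_iff)
  obtain s z where s: "s \<in> span (range G)" and orth: "\<And>w. w \<in> span (range G) \<Longrightarrow> orthogonal z w" and yz: "y = s + z"
    using orthogonal_subspace_decomp_exists[of "range G" y] by blast
  have "G z \<in> span (range G)" by (intro span_base) simp
  then have "0 = G z \<bullet> z" using orth[of "G z"] by (simp add: orthogonal_def inner_commute)
  also have "\<dots> = (\<integral>t. (g t \<bullet> z)\<^sup>2 \<partial>leb01)"
    unfolding G_def by (subst integral_inner_left[symmetric]) (use int in \<open>simp_all add: power2_eq_square\<close>)
  finally have "(\<integral>t. (g t \<bullet> z)\<^sup>2 \<partial>leb01) = 0" ..
  then have "AE t in leb01. (g t \<bullet> z)\<^sup>2 = 0"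
    by (subst (asm) integral_nonneg_eq_0_iff_AE) (auto intro: L2_power2_integrable gc)
  then have "AE t in leb01. h t * (g t \<bullet> z) = 0"
    by eventually_elim simp
  then have "(\<integral>t. h t * (g t \<bullet> z) \<partial>leb01) = 0" by (rule integral_eq_zero_AE)
  then have "y \<bullet> z = 0"
    unfolding y_def by (subst integral_inner_left[symmetric]) (use L2_scaleR_integrable[OF h gL] in simp_all)
  moreover have "s \<bullet> z = 0" using orth[OF s] by (simp add: orthogonal_def inner_commute)
  ultimately have "z = 0" by (simp add: yz inner_add_left)
  then have "y \<in> range G" using s span yz by simp
  then show thesis using that by (auto simp: G_def y_def)
qed

text \<open>
  The correction \<open>g \<bullet> c\<close> of \<open>v\<close> that restores the moments is found by solving the Gram system. It is
  orthogonal to all differences of elements of \<open>C\<close>, so the Pythagorean identity holds.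
\<close>

theorem proj_moment_set:
  fixes g :: "real \<Rightarrow> real^'n"
  assumes g: "continuous_on {0..1} g" and C: "C = {u \<in> L2. (\<integral>t. u t *\<^sub>R g t \<partial>leb01) = \<xi>}"
    and ne: "C \<noteq> {}" and v: "v \<in> L2"
  obtains c where "proj C v \<in> C" "AE t in leb01. proj C v t = v t - g t \<bullet> c"
proof -
  obtain u0 where u0: "u0 \<in> L2" "(\<integral>t. u0 t *\<^sub>R g t \<partial>leb01) = \<xi>" using ne C by auto
  obtain c where c: "(\<integral>t. (g t \<bullet> c) *\<^sub>R g t \<partial>leb01) = (\<integral>t. (v t - u0 t) *\<^sub>R g t \<partial>leb01)"
    using gram_range[OF g L2_diff[OF v u0(1)]] by blast
  define z where "z t = v t - g t \<bullet> c" for t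
  have gL: "g \<in> L2" by (rule L2_continuous[OF g])
  have gc: "(\<lambda>t. g t \<bullet> c) \<in> L2" by (intro L2_continuous continuous_intros g)
  have zL: "z \<in> L2" unfolding z_def by (intro L2_diff v gc)
  note [simp] = L2_scaleR_integrable[OF v gL] L2_scaleR_integrable[OF gc gL] L2_scaleR_integrable[OF u0(1) gL]
  have "(\<integral>t. z t *\<^sub>R g t \<partial>leb01) = \<xi>"
    using c u0(2) by (simp add: z_def scaleR_diff_left)
  then have z: "z \<in> C" using zL by (simp add: C)
  have pyth: "(\<integral>t. (v t - z t)\<^sup>2 \<partial>leb01) + (\<integral>t. (a t - z t)\<^sup>2 \<partial>leb01) \<le> (\<integral>t. (v t - a t)\<^sup>2 \<partial>leb01)"
    if a: "a \<in> C" for a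
  proof -
    have aL: "a \<in> L2" and am: "(\<integral>t. a t *\<^sub>R g t \<partial>leb01) = \<xi>" using a by (auto simp: C)
    have zm: "(\<integral>t. z t *\<^sub>R g t \<partial>leb01) = \<xi>" using z by (simp add: C)
    have azg: "integrable leb01 (\<lambda>t. (a t - z t) *\<^sub>R g t)" by (intro L2_scaleR_integrable L2_diff aL zL gL)
    have "(\<integral>t. (a t - z t) *\<^sub>R g t \<partial>leb01) = 0"
      using am zm L2_scaleR_integrable[OF aL gL] L2_scaleR_integrable[OF zL gL] by (simp add: scaleR_diff_left)
    then have cross: "(\<integral>t. (a t - z t) * (g t \<bullet> c) \<partial>leb01) = 0"
      using integral_inner_left[OF azg, of c] by simp
    have int: "integrable leb01 (\<lambda>t. (v t - z t)\<^sup>2)" "integrable leb01 (\<lambda>t. (a t - z t)\<^sup>2)"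
      "integrable leb01 (\<lambda>t. (a t - z t) * (g t \<bullet> c))"
      by (intro L2_power2_integrable L2_mult_integrable L2_diff v zL aL gc)+
    have "(\<integral>t. (v t - a t)\<^sup>2 \<partial>leb01) = (\<integral>t. ((v t - z t)\<^sup>2 + (a t - z t)\<^sup>2) - 2 * ((a t - z t) * (g t \<bullet> c)) \<partial>leb01)"
      by (rule Bochner_Integration.integral_cong) (simp_all add: z_def power2_eq_square algebra_simps)
    also have "\<dots> = (\<integral>t. (v t - z t)\<^sup>2 \<partial>leb01) + (\<integral>t. (a t - z t)\<^sup>2 \<partial>leb01)"
      using int cross by simp
    finally show ?thesis by simp
  qed
  have "C \<subseteq> L2" by (auto simp: C)
  from proj_eq_AE[OF this v z pyth] that[of c] show thesis by (simp add: z_def)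
qed

section \<open>Primal and dual optimality\<close>

text \<open>
  \<open>\<vartheta>(w, t)\<close> is the maximum of \<open>a w - r(t) a\<^sup>2 / 2\<close> over \<open>a \<in> [alo(t), ahi(t)]\<close>; the maximizer is the clamp of
  \<open>w / r(t)\<close>. This lemma gives the value at the maximizer, the next one maximality.
\<close>

lemma theta_eq:
  assumes "r t > 0" "alo t < ahi t"
  defines "a w \<equiv> max (alo t) (min (ahi t) (w / r t))"
  shows "theta r alo ahi w t = a w * w - r t * (a w)\<^sup>2 / 2"
proof -
  consider "w > r t * ahi t" | "w < r t * alo t" | "r t * alo t \<le> w" "w \<le> r t * ahi t" by linarith
  then show ?thesis
  proof cases
    case 1
    then have "ahi t < w / r t" using assms(1) by (simp add: field_simps)
    then show ?thesis using 1 assms(2) by (simp add: theta_def a_def)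
  next
    case 2
    then have "w / r t < alo t" using assms(1) by (simp add: field_simps)
    moreover have "r t * alo t < r t * ahi t" using assms by simp
    ultimately show ?thesis using 2 assms(2) by (simp add: theta_def a_def)
  next
    case 3
    then have "a w = w / r t" using assms(1) by (simp add: field_simps a_def)
    then show ?thesis using 3 assms(1) by (simp add: theta_def power2_eq_square field_simps)
  qed
qed

lemma theta_ge:
  assumes r: "r t > 0" and lh: "alo t < ahi t" and c: "alo t \<le> c" "c \<le> ahi t"
  shows "c * w - r t * c\<^sup>2 / 2 \<le> theta r alo ahi w t"
proof -
  define a where "a = max (alo t) (min (ahi t) (w / r t))"
  have "(w / r t - a) * (c - a) \<le> 0" unfolding a_def by (rule clamp_variational[OF c])
  then have "r t * ((w / r t - a) * (c - a)) \<le> 0" using r by (simp add: mult_nonneg_nonpos)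
  also have "r t * ((w / r t - a) * (c - a)) = (w - r t * a) * (c - a)" using r by (simp add: field_simps)
  finally have 1: "(w - r t * a) * (c - a) \<le> 0" .
  have 2: "0 \<le> r t / 2 * (a - c)\<^sup>2" using r by simp
  have "a * w - r t * a\<^sup>2 / 2 - (c * w - r t * c\<^sup>2 / 2) = - ((w - r t * a) * (c - a)) + r t / 2 * (a - c)\<^sup>2"
    by (simp add: power2_eq_square field_simps)
  then show ?thesis using 1 2 theta_eq[of r t alo ahi w, OF r lh] by (simp add: a_def)
qed

text \<open>
  The optimality conditions: a feasible control \<open>u\<close> and a multiplier \<open>p\<close> such that \<open>u\<close> is the pointwise
  maximizer for \<open>w = b \<bullet> p\<close>.
\<close>

context
  fixes A :: "real \<Rightarrow> real^'n^'n" and b :: "real \<Rightarrow> real^'n" and x0 xf :: "real^'n"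
    and r alo ahi :: "real \<Rightarrow> real" and u :: "real \<Rightarrow> real" and p :: "real \<Rightarrow> real^'n"
  assumes b: "continuous_on {0..1} b"
    and r: "continuous_on {0..1} r" and r_pos: "\<And>t. t \<in> {0..1} \<Longrightarrow> 0 < r t"
    and alo: "continuous_on {0..1} alo" and ahi: "continuous_on {0..1} ahi"
    and lh: "\<And>t. t \<in> {0..1} \<Longrightarrow> alo t < ahi t"
    and uA: "u \<in> setA A b x0 xf" and uB: "u \<in> setB alo ahi"
    and p: "adjoint_solution A p"
    and u_clamp: "AE t in leb01. u t = max (alo t) (min (ahi t) ((b t \<bullet> p t) / r t))"
begin

text \<open>
  Expanding \<open>r v\<^sup>2\<close> around \<open>u\<close>, the linear term is \<open>r u (v - u) = (r u - w) (v - u) + w (v - u)\<close>. The first summand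
  is nonnegative because \<open>u\<close> is the clamp of \<open>w / r\<close>; the second integrates to zero because \<open>u\<close> and \<open>v\<close> have the same
  pairing with \<open>p\<close>. The quadratic remainder gives uniqueness.
\<close>

lemma primal_growth:
  assumes vA: "v \<in> setA A b x0 xf" and vB: "v \<in> setB alo ahi"
  shows "primal_cost r u + 1/2 * (\<integral>t. r t * (v t - u t)\<^sup>2 \<partial>leb01) \<le> primal_cost r v"
proof -
  have uL: "u \<in> L2" and vL: "v \<in> L2" using uB vB by (auto simp: setB_def)
  have w: "(\<lambda>t. b t \<bullet> p t) \<in> L2" by (intro L2_continuous continuous_intros b adjoint_solutionD(2)[OF p])
  have rint: "integrable leb01 (\<lambda>t. r t * (f t)\<^sup>2)" if "f \<in> L2" for f
  proof -
    have "(\<lambda>t. f t *\<^sub>R r t) \<in> L2" by (rule L2_scaleR_continuous[OF that r])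
    from L2_mult_integrable[OF this that] show ?thesis by (simp add: power2_eq_square mult_ac)
  qed
  note int = rint[OF uL] rint[OF vL] rint[OF L2_diff[OF vL uL]] L2_mult_integrable[OF w uL] L2_mult_integrable[OF w vL]
  have "(\<integral>t. r t * (v t - u t)\<^sup>2 \<partial>leb01) \<le> (\<integral>t. r t * (v t)\<^sup>2 - r t * (u t)\<^sup>2 - 2 * ((b t \<bullet> p t) * v t - (b t \<bullet> p t) * u t) \<partial>leb01)"
  proof (rule integral_mono_AE)
    have "AE t in leb01. alo t \<le> v t \<and> v t \<le> ahi t" using vB by (simp add: setB_def)
    then show "AE t in leb01. r t * (v t - u t)\<^sup>2 \<le> r t * (v t)\<^sup>2 - r t * (u t)\<^sup>2 - 2 * ((b t \<bullet> p t) * v t - (b t \<bullet> p t) * u t)"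
      using u_clamp AE_space
    proof eventually_elim
      case (elim t)
      then have rt: "r t > 0" using r_pos by simp
      have "((b t \<bullet> p t) / r t - u t) * (v t - u t) \<le> 0"
        unfolding elim(2) by (rule clamp_variational) (use elim in auto)
      then have "r t * (((b t \<bullet> p t) / r t - u t) * (v t - u t)) \<le> 0"
        using rt by (simp add: mult_nonneg_nonpos)
      also have "r t * (((b t \<bullet> p t) / r t - u t) * (v t - u t)) = ((b t \<bullet> p t) - r t * u t) * (v t - u t)"
        using rt by (simp add: field_simps)
      finally have "((b t \<bullet> p t) - r t * u t) * (v t - u t) \<le> 0" .
      moreover have "r t * (v t)\<^sup>2 - r t * (u t)\<^sup>2 - 2 * ((b t \<bullet> p t) * v t - (b t \<bullet> p t) * u t)
        = r t * (v t - u t)\<^sup>2 - 2 * (((b t \<bullet> p t) - r t * u t) * (v t - u t))"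
        by (simp add: power2_eq_square algebra_simps)
      ultimately show ?case by linarith
    qed
  qed (use int in auto)
  also have "\<dots> = 2 * primal_cost r v - 2 * primal_cost r u"
    using int setA_adjoint_pairing[OF b uA p] setA_adjoint_pairing[OF b vA p] by (simp add: primal_cost_def)
  finally show ?thesis by simp
qed

lemma primal_solution_clamp: "primal_solution A b x0 xf r alo ahi u"
  unfolding primal_solution_def
proof (intro conjI ballI)
  fix v assume "v \<in> setA A b x0 xf \<inter> setB alo ahi"
  then have "primal_cost r u + 1/2 * (\<integral>t. r t * (v t - u t)\<^sup>2 \<partial>leb01) \<le> primal_cost r v"
    by (intro primal_growth) auto
  moreover have "0 \<le> (\<integral>t. r t * (v t - u t)\<^sup>2 \<partial>leb01)"
    using r_pos by (intro Bochner_Integration.integral_nonneg) (simp add: less_imp_le)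
  ultimately show "primal_cost r u \<le> primal_cost r v" by linarith
qed (use uA uB in auto)

lemma primal_solution_unique:
  assumes "primal_solution A b x0 xf r alo ahi v"
  shows "L2_eq v u"
proof -
  have v: "v \<in> setA A b x0 xf" "v \<in> setB alo ahi" "primal_cost r v \<le> primal_cost r u"
    using assms uA uB by (auto simp: primal_solution_def)
  have vu: "(\<lambda>t. v t - u t) \<in> L2" using v uB by (intro L2_diff) (auto simp: setB_def)
  have nn: "0 \<le> r t * (v t - u t)\<^sup>2" if "t \<in> space leb01" for t
    using r_pos[of t] that by (simp add: less_imp_le)
  have "(\<integral>t. r t * (v t - u t)\<^sup>2 \<partial>leb01) \<le> 0" using primal_growth[OF v(1,2)] v(3) by linarith
  moreover have "0 \<le> (\<integral>t. r t * (v t - u t)\<^sup>2 \<partial>leb01)" by (rule Bochner_Integration.integral_nonneg[OF nn])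
  ultimately have "(\<integral>t. r t * (v t - u t)\<^sup>2 \<partial>leb01) = 0" by linarith
  moreover have "integrable leb01 (\<lambda>t. r t * (v t - u t)\<^sup>2)"
    using L2_mult_integrable[OF L2_scaleR_continuous[OF vu r] vu] by (simp add: power2_eq_square mult_ac)
  ultimately have "AE t in leb01. r t * (v t - u t)\<^sup>2 = 0"
    using nn by (subst (asm) integral_nonneg_eq_0_iff_AE) (auto intro: AE_I2)
  then show ?thesis unfolding L2_eq_def
    using AE_space
  proof eventually_elim
    case (elim t)
    then show ?case using r_pos[of t] by auto
  qed
qed

text \<open>
  Since \<open>u\<close> is feasible, the boundary terms of the dual cost at \<open>(v, q)\<close> equal \<open>\<integral> v u\<close>, so the cost is
  \<open>\<integral> \<vartheta>(v) - v u\<close>. This is at least \<open>- \<integral> r u\<^sup>2 / 2\<close> pointwise, with equality for \<open>v = b \<bullet> p\<close>.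
\<close>

lemma dual_solution_multiplier: "dual_solution A b x0 xf r alo ahi (\<lambda>t. b t \<bullet> p t)"
  unfolding dual_solution_def
proof (intro exI conjI allI impI)
  have uL: "u \<in> L2" and uAE: "AE t in leb01. alo t \<le> u t \<and> u t \<le> ahi t" using uB by (auto simp: setB_def)
  have feas: "dual_feasible A b (\<lambda>t. b t \<bullet> p t) p"
    using p by (auto simp: dual_feasible_def intro!: L2_continuous continuous_intros b adjoint_solutionD(2)[OF p])
  then show "dual_feasible A b (\<lambda>t. b t \<bullet> p t) p" .
  have cost: "dual_cost x0 xf r alo ahi v q = (\<integral>t. theta r alo ahi (v t) t - v t * u t \<partial>leb01)"
    and cost_int: "integrable leb01 (\<lambda>t. theta r alo ahi (v t) t - v t * u t)" if vq: "dual_feasible A b v q" for v q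
  proof -
    have vL: "v \<in> L2" and q: "adjoint_solution A q" and v: "\<And>t. t \<in> {0..1} \<Longrightarrow> v t = b t \<bullet> q t"
      using vq by (auto simp: dual_feasible_def)
    let ?a = "\<lambda>t. max (alo t) (min (ahi t) ((b t \<bullet> q t) / r t))"
    have "continuous_on {0..1} (\<lambda>t. ?a t * (b t \<bullet> q t) - r t * (?a t)\<^sup>2 / 2)"
      using r_pos by (intro continuous_intros b r alo ahi adjoint_solutionD(2)[OF q]) (auto simp: less_imp_neq[symmetric])
    also have "?this \<longleftrightarrow> continuous_on {0..1} (\<lambda>t. theta r alo ahi (v t) t)"
      using r_pos lh v by (intro continuous_on_cong) (simp_all add: theta_eq)
    finally have th: "integrable leb01 (\<lambda>t. theta r alo ahi (v t) t)"
      by (rule continuous_imp_integrable_real)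
    have vu: "integrable leb01 (\<lambda>t. v t * u t)" by (rule L2_mult_integrable[OF vL uL])
    have "(\<integral>t. v t * u t \<partial>leb01) = (\<integral>t. (b t \<bullet> q t) * u t \<partial>leb01)"
      by (rule Bochner_Integration.integral_cong) (simp_all add: v)
    then have "(\<integral>t. v t * u t \<partial>leb01) = xf \<bullet> q 1 - x0 \<bullet> q 0"
      using setA_adjoint_pairing[OF b uA q] by simp
    with th vu show "dual_cost x0 xf r alo ahi v q = (\<integral>t. theta r alo ahi (v t) t - v t * u t \<partial>leb01)"
      by (simp add: dual_cost_def)
    show "integrable leb01 (\<lambda>t. theta r alo ahi (v t) t - v t * u t)" using th vu by simp
  qed
  fix v q assume vq: "dual_feasible A b v q"
  show "dual_cost x0 xf r alo ahi (\<lambda>t. b t \<bullet> p t) p \<le> dual_cost x0 xf r alo ahi v q"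
    unfolding cost[OF feas] cost[OF vq]
  proof (rule integral_mono_AE[OF cost_int[OF feas] cost_int[OF vq]])
    show "AE t in leb01. theta r alo ahi (b t \<bullet> p t) t - (b t \<bullet> p t) * u t \<le> theta r alo ahi (v t) t - v t * u t"
      using u_clamp uAE AE_space
    proof eventually_elim
      case (elim t)
      then have t: "r t > 0" "alo t < ahi t" using r_pos lh by auto
      have "theta r alo ahi (b t \<bullet> p t) t = u t * (b t \<bullet> p t) - r t * (u t)\<^sup>2 / 2"
        using theta_eq[of r t alo ahi "b t \<bullet> p t", OF t] elim(1) by simp
      moreover have "u t * v t - r t * (u t)\<^sup>2 / 2 \<le> theta r alo ahi (v t) t"
        by (rule theta_ge[of r t alo ahi, OF t]) (use elim in auto)
      ultimately show ?case by (simp add: mult.commute)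
    qed
  qed
qed

end

section \<open>Fixed points of the Douglas-Rachford operator\<close>

text \<open>
  In terms of monotone operators: \<open>u\<close> is the resolvent of the sum of \<open>r u\<close> and the normal cone of the interval
  at \<open>u + w\<close> iff \<open>w - r u\<close> lies in the normal cone at \<open>u\<close>. This turns the relation between \<open>u\<close> and \<open>\<phi> = u + w\<close> into one
  between \<open>u\<close> and \<open>w\<close> alone.
\<close>

lemma clamp_resolvent:
  fixes u w r lo hi :: real
  assumes r: "r > 0" and lh: "lo < hi" and u: "u = max lo (min hi ((u + w) / (1 + r)))"
  shows "u = max lo (min hi (w / r))"
proof -
  consider "(u + w) / (1 + r) < lo" | "hi < (u + w) / (1 + r)" | "lo \<le> (u + w) / (1 + r)" "(u + w) / (1 + r) \<le> hi" by linarith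
  then show ?thesis
  proof cases
    case 1
    then have "u = lo" using u lh by simp
    with 1 r have "w / r < lo" by (simp add: field_simps)
    then show ?thesis using \<open>u = lo\<close> lh by simp
  next
    case 2
    then have "u = hi" using u lh by simp
    with 2 r have "hi < w / r" by (simp add: field_simps)
    then show ?thesis using \<open>u = hi\<close> lh by simp
  next
    case 3
    then have eq: "u = (u + w) / (1 + r)" using u by simp
    then have "u = w / r" using r by (simp add: field_simps)
    moreover have "lo \<le> u" "u \<le> hi" using 3 eq by simp_all
    ultimately show ?thesis by simp
  qed
qed

theorem theorem2:
  fixes A :: "real \<Rightarrow> real^'n^'n" and b :: "real \<Rightarrow> real^'n"
    and x0 xf :: "real^'n"
    and r alo ahi \<phi> :: "real \<Rightarrow> real"
  assumes "continuous_on {0..1} A"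
    and "continuous_on {0..1} b"
    and "\<exists>t\<in>{0..1}. b t \<noteq> 0"
    and "continuous_on {0..1} r"
    and "\<And>t. t \<in> {0..1} \<Longrightarrow> 0 < r t"
    and "continuous_on {0..1} alo"
    and "continuous_on {0..1} ahi"
    and "\<And>t. t \<in> {0..1} \<Longrightarrow> alo t < ahi t"
    and "setA A b x0 xf \<noteq> {}"
    and "\<phi> \<in> L2"
    and "L2_eq (DR A b x0 xf r alo ahi \<phi>) \<phi>"
  shows "\<exists>l u w.
           adjoint_solution A l \<and>
           primal_solution A b x0 xf r alo ahi u \<and>
           (\<forall>u'. primal_solution A b x0 xf r alo ahi u' \<longrightarrow> L2_eq u' u) \<and>
           dual_solution A b x0 xf r alo ahi w \<and>
           (AE t in leb01.
              \<phi> t = u t + w t \<and>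
              \<phi> t =
                (if - (b t \<bullet> l t) > r t * ahi t then ahi t - b t \<bullet> l t
                 else if - (b t \<bullet> l t) < r t * alo t then alo t - b t \<bullet> l t
                 else - ((1 + r t) * (b t \<bullet> l t)) / r t))"
proof -
  note A = assms(1) and b = assms(2) and r = assms(4) and r_pos = assms(5) and alo = assms(6)
    and ahi = assms(7) and lh = assms(8) and ne = assms(9) and \<phi> = assms(10) and fixp = assms(11)
  obtain g :: "real \<Rightarrow> real^'n" and \<xi> where g: "continuous_on {0..1} g"
    and setA_eq: "setA A b x0 xf = {u \<in> L2. (\<integral>t. u t *\<^sub>R g t \<partial>leb01) = \<xi>}"
    and adj: "\<And>c. \<exists>p. adjoint_solution A p \<and> (\<forall>t. b t \<bullet> p t = g t \<bullet> c)"
    by (rule setA_characterization[OF A b, of x0 xf]) (rule that, assumption, assumption, blast)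
  have "continuous_on {0..1} (gam r)"
    unfolding gam_def[abs_def] using r_pos by (intro continuous_intros r) (auto simp: add_pos_pos less_imp_neq[symmetric])
  from L2_scaleR_continuous[OF \<phi> this] have g\<phi>: "(\<lambda>t. gam r t * \<phi> t) \<in> L2" by (simp add: mult.commute)
  define y where "y = proj (setB alo ahi) (\<lambda>t. gam r t * \<phi> t)"
  define z where "z = proj (setA A b x0 xf) (\<lambda>t. 2 * y t - \<phi> t)"
  have yB: "y \<in> setB alo ahi" and y: "AE t in leb01. y t = max (alo t) (min (ahi t) (gam r t * \<phi> t))"
    unfolding y_def using proj_setB[OF alo ahi _ g\<phi>] lh by (auto simp: less_imp_le)
  have yL: "y \<in> L2" using yB by (simp add: setB_def)
  have "(\<lambda>t. 2 * y t - \<phi> t) \<in> L2"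
    using L2_diff[OF L2_scaleR[OF yL, of 2] \<phi>] by simp
  from proj_moment_set[OF g setA_eq ne this, folded z_def]
  obtain c where zA: "z \<in> setA A b x0 xf" and z: "AE t in leb01. z t = 2 * y t - \<phi> t - g t \<bullet> c" .
  \<comment> \<open>The statement is in terms of \<open>\<lambda>\<close> with \<open>w = - b \<bullet> \<lambda>\<close>; the dual multiplier is an adjoint solution with the opposite sign.\<close>
  obtain l p where l: "adjoint_solution A l" "\<And>t. b t \<bullet> l t = g t \<bullet> c"
    and p: "adjoint_solution A p" "\<And>t. b t \<bullet> p t = - (g t \<bullet> c)"
    using adj[of c] adj[of "- c"] by auto
  \<comment> \<open>In the fixed point equation \<open>\<phi> - y + z = \<phi>\<close> the function \<open>\<phi>\<close> cancels.\<close>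
  have zy: "AE t in leb01. z t = y t"
    using fixp unfolding L2_eq_def DR_def Let_def y_def[symmetric] z_def[symmetric]
    by eventually_elim simp
  have zL: "z \<in> L2" using zA by (simp add: setA_eq)
  \<comment> \<open>\<open>y\<close> inherits feasibility from \<open>z\<close>, since moments do not see null sets.\<close>
  have yA: "y \<in> setA A b x0 xf"
  proof -
    have "(\<integral>t. y t *\<^sub>R g t \<partial>leb01) = (\<integral>t. z t *\<^sub>R g t \<partial>leb01)"
    proof (rule integral_cong_AE)
      show "AE t in leb01. y t *\<^sub>R g t = z t *\<^sub>R g t" using zy by eventually_elim simp
    qed (use L2_scaleR_continuous[OF yL g] L2_scaleR_continuous[OF zL g] in \<open>auto dest: L2D\<close>)
    then show ?thesis using zA yL by (simp add: setA_eq)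
  qed
  have \<phi>_eq: "AE t in leb01. \<phi> t = y t + b t \<bullet> p t"
    using z zy by eventually_elim (simp add: p(2))
  have y_clamp: "AE t in leb01. y t = max (alo t) (min (ahi t) ((b t \<bullet> p t) / r t))"
    using y \<phi>_eq AE_space
  proof eventually_elim
    case (elim t)
    then have t: "r t > 0" "alo t < ahi t" using r_pos lh by auto
    have "y t = max (alo t) (min (ahi t) ((y t + b t \<bullet> p t) / (1 + r t)))"
      using elim(1) unfolding elim(2) by (simp add: gam_def)
    then show ?case by (rule clamp_resolvent[OF t])
  qed
  have final: "AE t in leb01. \<phi> t = y t + b t \<bullet> p t \<and>
              \<phi> t =
                (if - (b t \<bullet> l t) > r t * ahi t then ahi t - b t \<bullet> l t
                 else if - (b t \<bullet> l t) < r t * alo t then alo t - b t \<bullet> l t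
                 else - ((1 + r t) * (b t \<bullet> l t)) / r t)"
    using \<phi>_eq y_clamp AE_space
  proof eventually_elim
    case (elim t)
    then have t: "r t > 0" "alo t < ahi t" using r_pos lh by auto
    define w where "w = b t \<bullet> p t"
    have bl: "b t \<bullet> l t = - w" by (simp add: w_def l(2) p(2))
    have yt: "y t = max (alo t) (min (ahi t) (w / r t))" using elim(2) by (simp add: w_def)
    have ft: "\<phi> t = y t + w" using elim(1) by (simp add: w_def)
    consider "w > r t * ahi t" | "w \<le> r t * ahi t" "w < r t * alo t" | "r t * alo t \<le> w" "w \<le> r t * ahi t" by linarith
    then have case_eq: "\<phi> t = (if w > r t * ahi t then ahi t + w
                 else if w < r t * alo t then alo t + w else ((1 + r t) * w) / r t)"
    proof cases
      case 1
      then have "ahi t < w / r t" using t(1) by (simp add: field_simps)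
      then show ?thesis using 1 t(2) by (simp add: ft yt)
    next
      case 2
      then have "w / r t < alo t" using t(1) by (simp add: field_simps)
      then show ?thesis using 2 t(2) by (simp add: ft yt)
    next
      case 3
      then have "y t = w / r t" using t(1) by (simp add: field_simps yt)
      then show ?thesis using 3 t(1) by (simp add: ft field_simps)
    qed
    show ?case
      by (rule conjI[OF elim(1)]) (simp only: bl minus_minus diff_minus_eq_add mult_minus_right case_eq[symmetric])
  qed
  note optimality = b r r_pos alo ahi lh yA yB p(1) y_clamp
  show ?thesis
  proof (intro exI conjI allI impI)
    show "primal_solution A b x0 xf r alo ahi y" by (rule primal_solution_clamp[OF optimality])
    show "L2_eq u' y" if "primal_solution A b x0 xf r alo ahi u'" for u'
      by (rule primal_solution_unique[OF optimality that])
    show "dual_solution A b x0 xf r alo ahi (\<lambda>t. b t \<bullet> p t)" by (rule dual_solution_multiplier[OF optimality])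
  qed (rule l(1), rule final)
qed

end
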